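(* Let $k$ be a field of characteristic zero. For every integer $n>0$, the inverse system $(\mathcal{I}_n^{\mathrm{Arc}})^\perp\subset k[\mathbf{x}^{(\infty)}]$ of the arc space of the double point defined by $\mathcal{I}_n=\langle x_ix_j\mid 1\leqslant i,j\leqslant n\rangle\subset k[x_1,\ldots,x_n]$ is equal to the $k$-linear span of the Wronskians $\mathrm{Wr}(S)$, where $S$ ranges over all finite subsets $S\subset \mathbf{x}^{(\infty)}=\{x_i^{(j)}\mid 1\leqslant i\leqslant n,\ j\geqslant 0\}$.
   Context: $k[\mathbf{x}^{(\infty)}]:=k[x_i^{(j)}\mid 1\leqslant i\leqslant n,\ j\geqslant 0]$ is the polynomial ring in the independent variables $x_i^{(j)}$ (formal derivatives of $x_i=x_i^{(0)}$). Arc ideal: put $x_i(t):=\sum_{j\geqslant 0}x_i^{(j)}t^j$ (no factorials). For an ideal $I\subset k[x_1,\ldots,x_n]$, $I^{\mathrm{Arc}}\subset k[\mathbf{x}^{(\infty)}]$ is the ideal generated by all coefficients with respect to $t$ of $f(x_1(t),\ldots,x_n(t))$, for all $f\in I$. In particular $\mathcal{I}_n^{\mathrm{Arc}}$ is generated by the polynomials $\sum_{s=0}^{\ell}x_i^{(s)}x_j^{(\ell-s)}$, $1\leqslant i\leqslant j\leqslant n$, $\ell\geqslant 0$. Inverse system: for polynomials $p,q$ in a polynomial ring, $p\bullet q$ denotes the result of applying to $q$ the constant-coefficient differential operator obtained from $p$ by replacing each variable $y$ by $\partial/\partial y$. Let $\mathfrak{m}$ be the ideal generated by all the variables. For an $\mathfrak{m}$-primary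 ideal $I$, $I^\perp$ is the $k$-vector space of all polynomials $f$ in the same ring such that $f\bullet p\in\mathfrak{m}$ for all $p\in I$. Wronskians: $k[\mathbf{x}^{(\infty)}]$ carries the $k$-linear derivation with $(x_i^{(j)})'=x_i^{(j+1)}$. For $f_1,\ldots,f_\ell\in k[\mathbf{x}^{(\infty)}]$, $\mathrm{Wr}(f_1,\ldots,f_\ell):=\det\big(f_j^{(i-1)}\big)_{1\leqslant i,j\leqslant \ell}$. For a finite set $S$, $\mathrm{Wr}(S)$ is the Wronskian of its elements listed in any order (well defined up to sign), and $\mathrm{Wr}(\varnothing)=1$. *)

theory Defs
  imports
    "HOL-Library.Poly_Mapping"
    "HOL-Computational_Algebra.Formal_Power_Series"
    "Jordan_Normal_Form.Determinant"
begin

section \<open>Polynomial rings\<close>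

text \<open>The polynomial ring over \<open>'k\<close> whose variables are the elements of the (possibly infinite)
  type \<open>'v\<close>: finitely supported functions from monomials to coefficients, where a monomial is a
  finitely supported function from variables to exponents.\<close>

type_synonym ('v, 'k) mpoly = "('v \<Rightarrow>\<^sub>0 nat) \<Rightarrow>\<^sub>0 'k"

definition Const :: "'k \<Rightarrow> ('v, 'k::comm_ring_1) mpoly" where
  "Const c = Poly_Mapping.single 0 c"

definition Var :: "'v \<Rightarrow> ('v, 'k::comm_ring_1) mpoly" where
  "Var v = Poly_Mapping.single (Poly_Mapping.single v 1) 1"

definition ideal_gen :: "'a::comm_ring_1 set \<Rightarrow> 'a set" where
  "ideal_gen S = Modules.module.span (*) S"

definition linear_span :: "('v, 'k::field) mpoly set \<Rightarrow> ('v, 'k) mpoly set" where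
  "linear_span S = Modules.module.span (\<lambda>c p. Const c * p) S"

definition max_ideal :: "('v, 'k::comm_ring_1) mpoly set" where
  "max_ideal = ideal_gen (range Var)"

section \<open>Inverse systems\<close>

text \<open>The partial derivative with respect to \<open>v\<close>, monomial by monomial. For monomials not involving
  \<open>v\<close> the exponent subtraction is truncated, but then the coefficient is \<open>0\<close>.\<close>

definition pdiff :: "'v \<Rightarrow> ('v, 'k::comm_ring_1) mpoly \<Rightarrow> ('v, 'k) mpoly" where
  "pdiff v p = (\<Sum>m\<in>Poly_Mapping.keys p. Poly_Mapping.single (m - Poly_Mapping.single v 1)
                              (of_nat (Poly_Mapping.lookup m v) * Poly_Mapping.lookup p m))"

text \<open>The operator obtained from a monomial \<open>m\<close>: the composition of the operators \<open>pdiff v\<close>, each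
  iterated as often as \<open>v\<close> occurs in \<open>m\<close>. The fold does not depend on the order of the variables
  since partial derivatives commute, see \<open>pdiff_commute\<close> and \<open>monom_diff_insert\<close> below.\<close>

definition monom_diff :: "('v \<Rightarrow>\<^sub>0 nat) \<Rightarrow> ('v, 'k::comm_ring_1) mpoly \<Rightarrow> ('v, 'k) mpoly" where
  "monom_diff m q =
     Finite_Set.fold (\<lambda>v. pdiff v ^^ Poly_Mapping.lookup m v) q (Poly_Mapping.keys m)"

text \<open>\<open>diff_apply p q\<close> is \<open>p \<bullet> q\<close>.\<close>

definition diff_apply :: "('v, 'k::comm_ring_1) mpoly \<Rightarrow> ('v, 'k) mpoly \<Rightarrow> ('v, 'k) mpoly" where
  "diff_apply p q = (\<Sum>m\<in>Poly_Mapping.keys p. Const (Poly_Mapping.lookup p m) * monom_diff m q)"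

definition inverse_system :: "('v, 'k::comm_ring_1) mpoly set \<Rightarrow> ('v, 'k) mpoly set" where
  "inverse_system I = {f. \<forall>p\<in>I. diff_apply f p \<in> max_ideal}"

section \<open>Arc ideals\<close>

text \<open>The variable \<open>(i, j)\<close> stands for \<open>x\<^sub>i\<^sup>(\<^sup>j\<^sup>)\<close>; the indices \<open>i\<close> range over a
  finite type \<open>'n\<close>, which plays the role of \<open>{1, \<dots>, n}\<close>.\<close>

definition arc_var :: "'n \<Rightarrow> ('n \<times> nat, 'k::comm_ring_1) mpoly fps" where
  "arc_var i = Abs_fps (\<lambda>j. Var (i, j))"

definition arc_subst :: "('n, 'k::comm_ring_1) mpoly \<Rightarrow> ('n \<times> nat, 'k) mpoly fps" where
  "arc_subst f = (\<Sum>m\<in>Poly_Mapping.keys f. fps_const (Const (Poly_Mapping.lookup f m)) *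
                                (\<Prod>i\<in>Poly_Mapping.keys m. arc_var i ^ Poly_Mapping.lookup m i))"

definition arc_ideal :: "('n, 'k::comm_ring_1) mpoly set \<Rightarrow> ('n \<times> nat, 'k) mpoly set" where
  "arc_ideal I = ideal_gen {fps_nth (arc_subst f) l | f l. f \<in> I}"

definition double_point_ideal :: "('n, 'k::comm_ring_1) mpoly set" where
  "double_point_ideal = ideal_gen {Var i * Var j | i j. True}"

section \<open>Wronskians\<close>

definition vars :: "('v, 'k::zero) mpoly \<Rightarrow> 'v set" where
  "vars p = (\<Union>m\<in>Poly_Mapping.keys p. Poly_Mapping.keys m)"

text \<open>The \<open>'k\<close>-linear derivation with \<open>(x\<^sub>i\<^sup>(\<^sup>j\<^sup>))' = x\<^sub>i\<^sup>(\<^sup>j\<^sup>+\<^sup>1\<^sup>)\<close>, by the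
  chain rule; its characterising properties are \<open>derivation_add\<close>, \<open>derivation_mult\<close>,
  \<open>derivation_Const\<close> and \<open>derivation_Var\<close> below.\<close>

definition derivation :: "('n \<times> nat, 'k::comm_ring_1) mpoly \<Rightarrow> ('n \<times> nat, 'k) mpoly" where
  "derivation p = (\<Sum>v\<in>vars p. pdiff v p * Var (fst v, Suc (snd v)))"

definition wronskian :: "('n \<times> nat, 'k::comm_ring_1) mpoly list \<Rightarrow> ('n \<times> nat, 'k) mpoly" where
  "wronskian fs = det (mat (length fs) (length fs) (\<lambda>(i, j). (derivation ^^ i) (fs ! j)))"

text \<open>The Wronskian of a finite set is only well defined up to sign, so we collect its values for
  all orderings of the set.\<close>

definition set_wronskians ::
    "('n \<times> nat, 'k::comm_ring_1) mpoly set \<Rightarrow> ('n \<times> nat, 'k) mpoly set" where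
  "set_wronskians S = {wronskian fs | fs. distinct fs \<and> set fs = S}"

section \<open>Basic properties\<close>

lemma module_ideal: "Modules.module ((*) :: 'a::comm_ring_1 \<Rightarrow> 'a \<Rightarrow> 'a)"
  by standard (simp_all add: algebra_simps)

lemma Const_add: "Const (a + b) = Const a + Const b"
  by (simp add: Const_def single_add)

lemma Const_mult: "Const (a * b) = Const a * Const b"
  by (simp add: Const_def mult_single)

lemma Const_1 [simp]: "Const 1 = 1"
  by (simp add: Const_def)

lemma vector_space_mpoly:
  "Vector_Spaces.vector_space (\<lambda>c p. Const c * p :: ('v, 'k::field) mpoly)"
  by standard (simp_all add: algebra_simps Const_add Const_mult)

lemma pdiff_superset:
  assumes "finite A" "Poly_Mapping.keys p \<subseteq> A"
  shows "pdiff v p = (\<Sum>m\<in>A. Poly_Mapping.single (m - Poly_Mapping.single v 1)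
                              (of_nat (Poly_Mapping.lookup m v) * Poly_Mapping.lookup p m))"
  unfolding pdiff_def by (rule sum.mono_neutral_left) (use assms in \<open>auto simp: in_keys_iff\<close>)

lemma pdiff_0 [simp]: "pdiff v 0 = 0"
  by (simp add: pdiff_def)

lemma pdiff_add: "pdiff v (p + q) = pdiff v p + pdiff v q"
  using keys_add[of p q]
  by (simp add: pdiff_superset[of "Poly_Mapping.keys p \<union> Poly_Mapping.keys q"] lookup_add single_add
      distrib_left sum.distrib)

lemma pdiff_monom:
  "pdiff v (Poly_Mapping.single m c) =
     Poly_Mapping.single (m - Poly_Mapping.single v 1) (of_nat (Poly_Mapping.lookup m v) * c)"
  by (subst pdiff_superset[of "{m}"]) auto

lemma mpoly_induct [case_names monom add]:
  assumes "\<And>m c. P (Poly_Mapping.single m c)" "\<And>p q. P p \<Longrightarrow> P q \<Longrightarrow> P (p + q)"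
  shows "P (p :: ('v, 'k::comm_ring_1) mpoly)"
proof -
  have "P (\<Sum>m\<in>A. Poly_Mapping.single m (Poly_Mapping.lookup p m))" if "finite A" for A
    using that
  proof induction
    case empty
    show ?case using assms(1)[of 0 0] by simp
  qed (simp add: assms)
  moreover have "(\<Sum>m\<in>Poly_Mapping.keys p. Poly_Mapping.single m (Poly_Mapping.lookup p m)) = p"
    by (rule poly_mapping_eqI) (simp add: lookup_sum lookup_single when_def sum.delta' in_keys_iff)
  ultimately show ?thesis by (metis finite_keys)
qed

lemma pdiff_mult: "pdiff v (p * q) = pdiff v p * q + p * pdiff v q"
proof (induction p rule: mpoly_induct)
  case (monom a c)
  show ?case
  proof (induction q rule: mpoly_induct)
    case (monom b d)
    let ?s = "Poly_Mapping.single v (1::nat)"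
    have 1: "a + b - ?s = a - ?s + b" if "Poly_Mapping.lookup a v \<noteq> 0"
      using that by (intro poly_mapping_eqI) (auto simp: lookup_add lookup_minus lookup_single when_def)
    have 2: "a + b - ?s = a + (b - ?s)" if "Poly_Mapping.lookup b v \<noteq> 0"
      using that by (intro poly_mapping_eqI) (auto simp: lookup_add lookup_minus lookup_single when_def)
    show ?case
      using 1 2
      by (cases "Poly_Mapping.lookup a v = 0"; cases "Poly_Mapping.lookup b v = 0")
         (simp_all add: pdiff_monom mult_single lookup_add algebra_simps flip: single_add)
  qed (simp add: pdiff_add algebra_simps)
qed (simp add: pdiff_add algebra_simps)

lemma pdiff_commute: "pdiff v (pdiff w p) = pdiff w (pdiff v p)"
proof (induction p rule: mpoly_induct)
  case (monom m c)
  have "m - Poly_Mapping.single v 1 - Poly_Mapping.single w 1 =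
        m - Poly_Mapping.single w 1 - Poly_Mapping.single v (1::nat)"
    by (rule poly_mapping_eqI) (simp add: lookup_minus)
  thus ?case
    by (simp add: pdiff_monom lookup_minus lookup_single when_def algebra_simps)
qed (simp add: pdiff_add)

lemma comp_fun_commute_pdiff:
  "comp_fun_commute (\<lambda>v. pdiff v ^^ e v :: ('v, 'k::comm_ring_1) mpoly \<Rightarrow> ('v, 'k) mpoly)"
proof
  fix v w
  have *: "pdiff v ((pdiff w ^^ b) q) = (pdiff w ^^ b) (pdiff v q)" for b and q :: "('v, 'k) mpoly"
    by (induction b) (simp_all, subst pdiff_commute, simp)
  have "(pdiff w ^^ b) ((pdiff v ^^ a) q) = (pdiff v ^^ a) ((pdiff w ^^ b) q)"
    for a b and q :: "('v, 'k) mpoly"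
    by (induction a) (simp_all flip: *)
  thus "(pdiff w ^^ e w) \<circ> (pdiff v ^^ e v) =
      ((pdiff v ^^ e v) \<circ> (pdiff w ^^ e w) :: ('v, 'k) mpoly \<Rightarrow> ('v, 'k) mpoly)"
    unfolding fun_eq_iff o_apply by blast
qed

lemma monom_diff_insert:
  fixes q :: "('v, 'k::comm_ring_1) mpoly"
  assumes "v \<in> Poly_Mapping.keys m"
  shows "monom_diff m q =
    (pdiff v ^^ Poly_Mapping.lookup m v)
       (Finite_Set.fold (\<lambda>v. pdiff v ^^ Poly_Mapping.lookup m v) q (Poly_Mapping.keys m - {v}))"
proof -
  interpret comp_fun_commute "\<lambda>v. pdiff v ^^ Poly_Mapping.lookup m v :: ('v, 'k) mpoly \<Rightarrow> _"
    by (rule comp_fun_commute_pdiff)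
  show ?thesis
    unfolding monom_diff_def using assms by (simp add: fold_rec)
qed

lemma finite_vars [simp]: "finite (vars p)"
  by (simp add: vars_def)

lemma pdiff_eq_0: "v \<notin> vars p \<Longrightarrow> pdiff v p = 0"
  by (auto simp: vars_def pdiff_def in_keys_iff intro!: sum.neutral)

lemma derivation_superset:
  assumes "finite A" "vars p \<subseteq> A"
  shows "derivation p = (\<Sum>v\<in>A. pdiff v p * Var (fst v, Suc (snd v)))"
  unfolding derivation_def
proof (rule sum.mono_neutral_left)
  show "\<forall>v\<in>A - vars p. pdiff v p * Var (fst v, Suc (snd v)) = 0"
    by (metis DiffD2 mult_zero_left pdiff_eq_0)
qed (use assms in auto)

lemma derivation_add: "derivation (p + q) = derivation p + derivation q"
proof -
  define A where "A = vars p \<union> vars q \<union> vars (p + q)"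
  have *: "derivation r = (\<Sum>v\<in>A. pdiff v r * Var (fst v, Suc (snd v)))"
    if "r \<in> {p, q, p + q}" for r
    by (rule derivation_superset) (use that in \<open>auto simp: A_def\<close>)
  show ?thesis
    by (simp add: * pdiff_add distrib_right sum.distrib)
qed

lemma derivation_mult: "derivation (p * q) = derivation p * q + p * derivation q"
proof -
  define A where "A = vars p \<union> vars q \<union> vars (p * q)"
  have *: "derivation r = (\<Sum>v\<in>A. pdiff v r * Var (fst v, Suc (snd v)))"
    if "r \<in> {p, q, p * q}" for r
    by (rule derivation_superset) (use that in \<open>auto simp: A_def\<close>)
  show ?thesis
    by (simp add: * pdiff_mult algebra_simps sum.distrib sum_distrib_left sum_distrib_right)
qed

lemma derivation_Const [simp]: "derivation (Const c) = 0"
  by (auto simp: derivation_def vars_def Const_def)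

lemma derivation_Var [simp]: "derivation (Var (i, j)) = Var (i, Suc j)"
  by (subst derivation_superset[of "{(i, j)}"])
     (auto simp: vars_def Var_def pdiff_monom split: if_splits)

end

theory Submission
  imports Defs
begin

text \<open>
  The constant term of \<open>f \<bullet> p\<close> is a symmetric bilinear form \<open>\<langle>f, p\<rangle>\<close>, for which multiplication by a
  variable is adjoint to differentiation. So \<open>f\<close> belongs to the inverse system iff it is orthogonal to
  all multiples of the convolutions \<open>\<Sum>\<^sub>s x\<^sub>i\<^sup>(\<^sup>s\<^sup>) x\<^sub>j\<^sup>(\<^sup>l\<^sup>-\<^sup>s\<^sup>)\<close>,
  which generate the arc ideal (\<open>arc_ideal_double_point\<close>).

  The Wronskians have this property because the corresponding differential operator, applied to the
  Leibniz expansion of the determinant, is antisymmetric under exchanging the two entries it removes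
  (\<open>wronskian_Vars_in_arc_perp\<close>).

  For the converse, fix a degree \<open>d\<close> and a sequence of \<open>d\<close> indices, called colours below, and collect
  the pairings of \<open>f\<close> with all products of \<open>d\<close> variables of these colours in a generating polynomial:
  \<open>F(y\<^sub>0, \<dots>, y\<^sub>d\<^sub>-\<^sub>1) = \<langle>f, x\<^sub>i\<^sub>0(y\<^sub>0) \<cdots> x\<^sub>i\<^sub>d\<^sub>-\<^sub>1(y\<^sub>d\<^sub>-\<^sub>1)\<rangle>\<close>. Orthogonality to the arc ideal says
  that \<open>F\<close> vanishes whenever two of the \<open>y\<close>'s coincide (\<open>identify_generating_poly\<close>). Hence the Vandermonde
  polynomial \<open>\<Prod>\<^bsub>a<b\<^esub> (y\<^sub>b - y\<^sub>a)\<close> divides \<open>F\<close>. On the other hand, by Taylor's formula the part of degree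
  \<open>d\<close> of \<open>f\<close> is, up to the factor \<open>d!\<close>, the sum over all colourings of the image of \<open>F\<close> under the linear
  map sending \<open>y\<^sub>0^e\<^sub>0 \<cdots> y\<^sub>d\<^sub>-\<^sub>1^e\<^sub>d\<^sub>-\<^sub>1\<close> to the product of the variables with the given colours and orders
  \<open>e\<^sub>0, \<dots>, e\<^sub>d\<^sub>-\<^sub>1\<close> (\<open>taylor_part_umbral\<close>). By the Leibniz formula this map sends the Vandermonde polynomial
  times a monomial to a Wronskian (\<open>umbral_vandermonde_monom\<close>). So \<open>f\<close> is a combination of Wronskians.\<close>

section \<open>Polynomials and ideals\<close>

abbreviation vmon :: "'v \<Rightarrow> 'v \<Rightarrow>\<^sub>0 nat" where
  "vmon v \<equiv> Poly_Mapping.single v 1"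

lemma ideal_gen_0: "0 \<in> ideal_gen S"
  unfolding ideal_gen_def by (rule module.span_zero[OF module_ideal])

lemma ideal_gen_base: "s \<in> S \<Longrightarrow> s \<in> ideal_gen S"
  unfolding ideal_gen_def by (rule module.span_base[OF module_ideal])

lemma ideal_gen_add: "p \<in> ideal_gen S \<Longrightarrow> q \<in> ideal_gen S \<Longrightarrow> p + q \<in> ideal_gen S"
  unfolding ideal_gen_def by (rule module.span_add[OF module_ideal])

lemma ideal_gen_mult: "p \<in> ideal_gen S \<Longrightarrow> q * p \<in> ideal_gen S"
  unfolding ideal_gen_def by (rule module.span_scale[OF module_ideal])

lemma ideal_gen_induct [consumes 1, case_names zero add mult gen]:
  assumes "p \<in> ideal_gen S" "P 0" "\<And>p q. P p \<Longrightarrow> P q \<Longrightarrow> P (p + q)"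
    "\<And>p q. P p \<Longrightarrow> P (q * p)" "\<And>s. s \<in> S \<Longrightarrow> P s"
  shows "P p"
  using assms(1) unfolding ideal_gen_def
proof (rule module.span_induct[OF module_ideal])
  show "module.subspace (*) {p. P p}"
    unfolding module.subspace_def[OF module_ideal] using assms by auto
qed (use assms in auto)

lemma mpoly_sum_monoms:
  "p = (\<Sum>m\<in>Poly_Mapping.keys p. Poly_Mapping.single m (Poly_Mapping.lookup p m))"
  by (rule poly_mapping_eqI) (simp add: lookup_sum lookup_single when_def in_keys_iff)

lemma lookup_single_mult:
  fixes p :: "('v, 'k::comm_ring_1) mpoly"
  shows "Poly_Mapping.lookup (Poly_Mapping.single m c * p) (m + k) = c * Poly_Mapping.lookup p k"
  by (induction p rule: mpoly_induct)
     (simp_all add: mult_single lookup_single when_def lookup_add algebra_simps)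

lemma lookup_Const_mult:
  "Poly_Mapping.lookup (Const c * p) k = c * Poly_Mapping.lookup p k"
  using lookup_single_mult[of 0 c p k] by (simp add: Const_def)

lemma Const_single: "Const c * Poly_Mapping.single m d = Poly_Mapping.single m (c * d)"
  by (simp add: Const_def mult_single)

lemma vmon_neq_0 [simp]: "Poly_Mapping.single v (Suc 0) \<noteq> 0"
proof
  assume "Poly_Mapping.single v (Suc 0) = 0"
  hence "Poly_Mapping.lookup (Poly_Mapping.single v (Suc 0)) v = 0" by simp
  thus False by simp
qed

lemma nonzero_monomial_var:
  assumes "m \<noteq> 0"
  obtains v where "Poly_Mapping.lookup m v \<noteq> (0::nat)"
proof -
  have "m = 0" if "\<forall>v. Poly_Mapping.lookup m v = 0"
    using that by (intro poly_mapping_eqI) simp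
  thus ?thesis using assms that by blast
qed

lemma monomial_split_var:
  assumes "Poly_Mapping.lookup m v \<noteq> (0::nat)"
  shows "vmon v + (m - vmon v) = m"
  using assms by (intro poly_mapping_eqI) (auto simp: lookup_add lookup_minus lookup_single when_def)

lemma lookup_Var_mult:
  fixes p :: "('v, 'k::comm_ring_1) mpoly"
  shows "Poly_Mapping.lookup (Var v * p) m =
    (if Poly_Mapping.lookup m v = 0 then 0 else Poly_Mapping.lookup p (m - vmon v))"
proof (cases "Poly_Mapping.lookup m v = 0")
  case True
  have "Poly_Mapping.lookup (Var v * p) m = 0"
  proof (induction p rule: mpoly_induct)
    case (monom b c)
    have "vmon v + b \<noteq> m"
      using True by (metis add_is_0 lookup_add lookup_single_eq one_neq_zero)
    thus ?case by (simp add: Var_def mult_single lookup_single when_def)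
  qed (simp add: lookup_add algebra_simps)
  with True show ?thesis by simp
next
  case False
  thus ?thesis
    using lookup_single_mult[of "vmon v" 1 p "m - vmon v"]
    by (simp only: Var_def monomial_split_var[OF False] if_False mult_1_left)
qed

lemma max_ideal_iff: "p \<in> max_ideal \<longleftrightarrow> Poly_Mapping.lookup p 0 = 0"
proof
  assume "p \<in> max_ideal"
  thus "Poly_Mapping.lookup p 0 = 0"
    unfolding max_ideal_def
  proof (induction rule: ideal_gen_induct)
    case (mult p q)
    show ?case
    proof (induction q rule: mpoly_induct)
      case (monom m c)
      show ?case
      proof (cases "m = 0")
        case True
        thus ?thesis using mult lookup_single_mult[of 0 c p 0] by simp
      next
        case False
        then obtain v where "Poly_Mapping.lookup m v \<noteq> 0"
          by (rule nonzero_monomial_var)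
        from monomial_split_var[OF this]
        have "Poly_Mapping.single m c = Var v * Poly_Mapping.single (m - vmon v) c"
          by (simp only: Var_def mult_single mult_1_left)
        hence "Poly_Mapping.single m c * p = Var v * (Poly_Mapping.single (m - vmon v) c * p)"
          by (simp only: mult.assoc)
        thus ?thesis by (simp add: lookup_Var_mult)
      qed
    qed (simp add: algebra_simps lookup_add)
  qed (auto simp: lookup_add Var_def lookup_single when_def)
next
  assume *: "Poly_Mapping.lookup p 0 = 0"
  have "(\<Sum>m\<in>A. Poly_Mapping.single m (Poly_Mapping.lookup p m)) \<in> max_ideal" if "finite A" for A
    using that
  proof induction
    case empty
    show ?case by (simp add: max_ideal_def ideal_gen_0)
  next
    case (insert m A)
    have "Poly_Mapping.single m (Poly_Mapping.lookup p m) \<in> max_ideal"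
    proof (cases "m = 0")
      case True
      thus ?thesis using * by (simp add: max_ideal_def ideal_gen_0)
    next
      case False
      then obtain v where "Poly_Mapping.lookup m v \<noteq> 0"
        by (rule nonzero_monomial_var)
      from monomial_split_var[OF this]
      have "Poly_Mapping.single m (Poly_Mapping.lookup p m) =
          Poly_Mapping.single (m - vmon v) (Poly_Mapping.lookup p m) * Var v"
        by (simp only: Var_def mult_single mult_1_right add.commute[of _ "vmon v"])
      thus ?thesis by (simp add: max_ideal_def ideal_gen_base ideal_gen_mult)
    qed
    thus ?case using insert by (simp add: max_ideal_def ideal_gen_add)
  qed
  from this[OF finite_keys[of p]] show "p \<in> max_ideal"
    by (subst mpoly_sum_monoms)
qed

section \<open>The apolar pairing\<close>

lemma lookup_pdiff:
  "Poly_Mapping.lookup (pdiff v p) k =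
     of_nat (Suc (Poly_Mapping.lookup k v)) * Poly_Mapping.lookup p (k + vmon v)"
proof (induction p rule: mpoly_induct)
  case (monom m c)
  have "m - vmon v = k \<longleftrightarrow> m = k + vmon v" if "Poly_Mapping.lookup m v \<noteq> 0"
  proof
    assume "m - vmon v = k"
    thus "m = k + vmon v" using that
      by (intro poly_mapping_eqI) (auto simp: lookup_add lookup_minus lookup_single when_def)
  qed simp
  moreover have "m \<noteq> k + vmon v" if "Poly_Mapping.lookup m v = 0"
    using that by (metis add_is_0 lookup_add lookup_single_eq one_neq_zero)
  ultimately show ?case
    by (cases "Poly_Mapping.lookup m v = 0")
       (auto simp: pdiff_monom lookup_single when_def lookup_add)
qed (simp add: pdiff_add lookup_add algebra_simps)

text \<open>Each derivative contributes the exponent of \<open>v\<close> that it lowers. These exponents run from \<open>n\<close> down to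
  \<open>1\<close> since \<open>v\<close> does not occur in \<open>k\<close>; for general \<open>k\<close> the factor would be a rising factorial.\<close>

lemma lookup_pdiff_funpow:
  fixes p :: "('v, 'k::field_char_0) mpoly"
  assumes "Poly_Mapping.lookup k v = 0"
  shows "Poly_Mapping.lookup ((pdiff v ^^ n) p) k =
    fact n * Poly_Mapping.lookup p (k + Poly_Mapping.single v n)"
proof (induction n arbitrary: p)
  case (Suc n)
  have "Poly_Mapping.lookup ((pdiff v ^^ Suc n) p) k =
      Poly_Mapping.lookup ((pdiff v ^^ n) (pdiff v p)) k"
    by (simp add: funpow_swap1)
  also have "\<dots> = fact n * (of_nat (Suc n) * 
      Poly_Mapping.lookup p (k + Poly_Mapping.single v n + vmon v))"
    using assms by (simp add: Suc lookup_pdiff lookup_add)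
  also have "k + Poly_Mapping.single v n + vmon v = k + Poly_Mapping.single v (Suc n)"
    by (simp add: add.assoc flip: single_add)
  finally show ?case by (simp add: algebra_simps)
qed simp

text \<open>Applying the operator of a monomial and reading off the constant term extracts one coefficient,
  scaled by the factorials of the exponents. In particular the constant term of \<open>f \<bullet> p\<close> is the symmetric
  bilinear form \<open>\<Sum>\<^sub>m m! f\<^sub>m p\<^sub>m\<close>.\<close>

lemma lookup_monom_diff_0:
  fixes q :: "('v, 'k::field_char_0) mpoly"
  shows "Poly_Mapping.lookup (monom_diff m q) 0 =
    (\<Prod>v\<in>Poly_Mapping.keys m. fact (Poly_Mapping.lookup m v)) * Poly_Mapping.lookup q m"
proof -
  interpret comp_fun_commute "\<lambda>v. pdiff v ^^ Poly_Mapping.lookup m v :: ('v, 'k) mpoly \<Rightarrow> _"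
    by (rule comp_fun_commute_pdiff)
  have *: "Poly_Mapping.lookup
      (Finite_Set.fold (\<lambda>v. pdiff v ^^ Poly_Mapping.lookup m v) q A) k =
      (\<Prod>v\<in>A. fact (Poly_Mapping.lookup m v)) *
      Poly_Mapping.lookup q (k + (\<Sum>v\<in>A. Poly_Mapping.single v (Poly_Mapping.lookup m v)))"
    if "finite A" "\<forall>v\<in>A. Poly_Mapping.lookup k v = 0" for A k
    using that
  proof (induction arbitrary: k)
    case (insert v A)
    have "\<forall>w\<in>A. Poly_Mapping.lookup (k + Poly_Mapping.single v (Poly_Mapping.lookup m v)) w = 0"
      using insert by (auto simp: lookup_add lookup_single when_def)
    thus ?case using insert
      by (simp add: lookup_pdiff_funpow algebra_simps)
  qed simp
  have "(\<Sum>v\<in>Poly_Mapping.keys m. Poly_Mapping.single v (Poly_Mapping.lookup m v)) = m"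
    by (rule poly_mapping_eqI) (simp add: lookup_sum lookup_single when_def in_keys_iff)
  thus ?thesis unfolding monom_diff_def using *[of "Poly_Mapping.keys m" 0] by simp
qed

definition multi_fact :: "('v \<Rightarrow>\<^sub>0 nat) \<Rightarrow> 'k::field_char_0" where
  "multi_fact m = (\<Prod>v\<in>Poly_Mapping.keys m. fact (Poly_Mapping.lookup m v))"

definition pairing :: "('v, 'k::field_char_0) mpoly \<Rightarrow> ('v, 'k) mpoly \<Rightarrow> 'k" where
  "pairing f p = Poly_Mapping.lookup (diff_apply f p) 0"

lemma inverse_system_pairing: "f \<in> inverse_system I \<longleftrightarrow> (\<forall>p\<in>I. pairing f p = 0)"
  by (simp add: inverse_system_def max_ideal_iff pairing_def)

lemma pairing_superset:
  assumes "finite A" "Poly_Mapping.keys f \<subseteq> A"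
  shows "pairing f p = (\<Sum>m\<in>A. Poly_Mapping.lookup f m * multi_fact m * Poly_Mapping.lookup p m)"
  unfolding pairing_def diff_apply_def
  by (simp add: lookup_sum lookup_Const_mult lookup_monom_diff_0 multi_fact_def mult.assoc)
     (rule sum.mono_neutral_left, use assms in \<open>auto simp: in_keys_iff\<close>)

lemma pairing_0 [simp]: "pairing 0 p = 0" "pairing f 0 = 0"
  by (simp_all add: pairing_superset[OF finite_keys order_refl])

lemma pairing_add_left: "pairing (f + g) p = pairing f p + pairing g p"
  using keys_add[of f g]
  by (simp add: pairing_superset[of "Poly_Mapping.keys f \<union> Poly_Mapping.keys g"] lookup_add
      algebra_simps sum.distrib)

lemma pairing_add_right: "pairing f (p + q) = pairing f p + pairing f q"
  by (simp add: pairing_superset[OF finite_keys order_refl] lookup_add algebra_simps sum.distrib)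

lemma pairing_Const_left: "pairing (Const c * f) p = c * pairing f p"
proof -
  have "Poly_Mapping.keys (Const c * f) \<subseteq> Poly_Mapping.keys f"
    by (auto simp: in_keys_iff lookup_Const_mult)
  thus ?thesis
    by (simp add: pairing_superset[OF finite_keys, of _ f] lookup_Const_mult sum_distrib_left
        mult.assoc)
qed

lemma pairing_sum_left: "pairing (sum f A) p = (\<Sum>x\<in>A. pairing (f x) p)"
  by (induction A rule: infinite_finite_induct) (auto simp: pairing_add_left)

lemma pairing_sum_right: "pairing f (sum p A) = (\<Sum>x\<in>A. pairing f (p x))"
  by (induction A rule: infinite_finite_induct) (auto simp: pairing_add_right)

lemma pairing_monom_left:
  "pairing (Poly_Mapping.single m c) p = c * multi_fact m * Poly_Mapping.lookup p m"
  by (subst pairing_superset[of "{m}"]) auto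

lemma pairing_1_right: "pairing f 1 = Poly_Mapping.lookup f 0"
  by (induction f rule: mpoly_induct)
     (auto simp: pairing_monom_left pairing_add_left lookup_add lookup_one lookup_single when_def
        multi_fact_def)

lemma multi_fact_superset:
  "finite A \<Longrightarrow> Poly_Mapping.keys m \<subseteq> A \<Longrightarrow> multi_fact m = (\<Prod>v\<in>A. fact (Poly_Mapping.lookup m v))"
  unfolding multi_fact_def by (rule prod.mono_neutral_left) (auto simp: in_keys_iff)

lemma multi_fact_reduce:
  assumes "Poly_Mapping.lookup m v \<noteq> 0"
  shows "(multi_fact m :: 'k::field_char_0) = of_nat (Poly_Mapping.lookup m v) * multi_fact (m - vmon v)"
proof -
  define A where "A = Poly_Mapping.keys m"
  have v: "v \<in> A" "finite A" using assms by (auto simp: A_def in_keys_iff)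
  have "Poly_Mapping.keys (m - vmon v) \<subseteq> A"
    by (auto simp: A_def in_keys_iff lookup_minus)
  hence "(multi_fact (m - vmon v) :: 'k) = (\<Prod>w\<in>A. fact (Poly_Mapping.lookup (m - vmon v) w))"
    using v by (intro multi_fact_superset)
  also have "\<dots> = fact (Poly_Mapping.lookup m v - 1) * (\<Prod>w\<in>A-{v}. fact (Poly_Mapping.lookup m w))"
    using v by (subst prod.remove[of _ v]) (auto simp: lookup_minus lookup_single when_def intro!: prod.cong split: if_splits)
  finally have 1: "(multi_fact (m - vmon v) :: 'k) = \<dots>" .
  have "(multi_fact m :: 'k) = fact (Poly_Mapping.lookup m v) * (\<Prod>w\<in>A-{v}. fact (Poly_Mapping.lookup m w))"
    using v by (simp add: multi_fact_def prod.remove A_def)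
  moreover have "fact (Poly_Mapping.lookup m v) =
      (of_nat (Poly_Mapping.lookup m v) * fact (Poly_Mapping.lookup m v - 1) :: 'k)"
    using assms by (cases "Poly_Mapping.lookup m v") (auto simp: algebra_simps)
  ultimately show ?thesis using 1 by (simp add: mult.assoc)
qed

text \<open>Multiplication by a variable is adjoint to differentiation. This turns orthogonality to an ideal into
  a system of constant-coefficient differential equations.\<close>

lemma pairing_Var_mult: "pairing f (Var v * p) = pairing (pdiff v f) p"
proof (induction f rule: mpoly_induct)
  case (monom m c)
  show ?case
    by (cases "Poly_Mapping.lookup m v = 0")
       (simp_all add: pdiff_monom pairing_monom_left lookup_Var_mult multi_fact_reduce)
qed (simp_all add: pdiff_add pairing_add_left)

section \<open>Generators of the arc ideal\<close>

lemma arc_subst_superset: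
  fixes f :: "('n::finite, 'k::comm_ring_1) mpoly"
  assumes "finite A" "Poly_Mapping.keys f \<subseteq> A"
  shows "arc_subst f = (\<Sum>m\<in>A. fps_const (Const (Poly_Mapping.lookup f m)) *
           (\<Prod>i\<in>UNIV. arc_var i ^ Poly_Mapping.lookup m i))"
proof -
  have "(\<Prod>i\<in>Poly_Mapping.keys m. arc_var i ^ Poly_Mapping.lookup m i :: ('n \<times> nat, 'k) mpoly fps) =
      (\<Prod>i\<in>UNIV. arc_var i ^ Poly_Mapping.lookup m i)" for m
    by (rule prod.mono_neutral_left) (auto simp: in_keys_iff)
  thus ?thesis unfolding arc_subst_def
    by simp (rule sum.mono_neutral_left, use assms in \<open>auto simp: in_keys_iff Const_def\<close>)
qed

lemma arc_subst_monom:
  fixes c :: "'k::comm_ring_1" and m :: "'n::finite \<Rightarrow>\<^sub>0 nat"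
  shows "arc_subst (Poly_Mapping.single m c) =
    fps_const (Const c) * (\<Prod>i\<in>UNIV. arc_var i ^ Poly_Mapping.lookup m i)"
  by (subst arc_subst_superset[of "{m}"]) auto

lemma arc_subst_add:
  fixes f g :: "('n::finite, 'k::comm_ring_1) mpoly"
  shows "arc_subst (f + g) = arc_subst f + arc_subst g"
  using keys_add[of f g]
  by (simp add: arc_subst_superset[of "Poly_Mapping.keys f \<union> Poly_Mapping.keys g"] lookup_add
      Const_add distrib_right sum.distrib flip: fps_const_add)

lemma arc_subst_mult:
  fixes f g :: "('n::finite, 'k::comm_ring_1) mpoly"
  shows "arc_subst (f * g) = arc_subst f * arc_subst g"
proof (induction f rule: mpoly_induct)
  case (monom a c)
  show ?case
  proof (induction g rule: mpoly_induct)
    case (monom b d)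
    show ?case
      by (simp add: mult_single arc_subst_monom lookup_add power_add prod.distrib Const_mult mult_ac
          flip: fps_const_mult)
  qed (simp add: arc_subst_add distrib_left)
qed (simp add: arc_subst_add distrib_right)

lemma arc_subst_0 [simp]: "arc_subst 0 = 0"
  by (simp add: arc_subst_def)

lemma arc_subst_Var: "arc_subst (Var i) = (arc_var (i :: 'n::finite) :: ('n \<times> nat, 'k::comm_ring_1) mpoly fps)"
proof -
  have "(\<Prod>j\<in>UNIV. arc_var j ^ Poly_Mapping.lookup (vmon i) j :: ('n \<times> nat, 'k) mpoly fps) =
      (\<Prod>j\<in>UNIV. if i = j then arc_var j else 1)"
    by (rule prod.cong) (auto simp: lookup_single when_def)
  thus ?thesis by (simp add: Var_def arc_subst_monom)
qed

definition arc_generator :: "'n \<Rightarrow> 'n \<Rightarrow> nat \<Rightarrow> ('n \<times> nat, 'k::comm_ring_1) mpoly" where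
  "arc_generator i j l = (\<Sum>s\<le>l. Var (i, s) * Var (j, l - s))"

lemma arc_subst_generator:
  "fps_nth (arc_subst (Var i * Var j :: ('n::finite, 'k::comm_ring_1) mpoly)) l = arc_generator i j l"
  by (simp add: arc_subst_mult arc_subst_Var fps_mult_nth arc_var_def arc_generator_def
      atLeast0AtMost)

lemma ideal_gen_sum: "(\<And>x. x \<in> A \<Longrightarrow> f x \<in> ideal_gen S) \<Longrightarrow> sum f A \<in> ideal_gen S"
  by (induction A rule: infinite_finite_induct) (auto simp: ideal_gen_0 ideal_gen_add)

text \<open>Substituting power series is a ring homomorphism, so the coefficients of the image of
  \<open>g x\<^sub>i x\<^sub>j\<close> are combinations of those of the image of \<open>x\<^sub>i x\<^sub>j\<close>: the convolutions
  \<open>arc_generator i j l\<close> generate.\<close>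

lemma arc_ideal_double_point:
  "arc_ideal (double_point_ideal :: ('n::finite, 'k::comm_ring_1) mpoly set) =
     ideal_gen {arc_generator i j l | i j l. True}"  (is "_ = ?J")
proof
  have coeffs: "\<forall>l. fps_nth (arc_subst g) l \<in> ?J"
    if "g \<in> double_point_ideal" for g :: "('n, 'k) mpoly"
    using that unfolding double_point_ideal_def
  proof (induction rule: ideal_gen_induct)
    case (mult p q)
    thus ?case
      by (auto simp: arc_subst_mult fps_mult_nth intro!: ideal_gen_sum ideal_gen_mult)
  next
    case (gen s)
    thus ?case by (force simp: arc_subst_generator intro: ideal_gen_base)
  qed (auto simp: arc_subst_add ideal_gen_0 ideal_gen_add)
  show "arc_ideal (double_point_ideal :: ('n, 'k) mpoly set) \<subseteq> ?J"
  proof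
    fix p :: "('n \<times> nat, 'k) mpoly"
    assume "p \<in> arc_ideal double_point_ideal"
    thus "p \<in> ?J" unfolding arc_ideal_def
      by (induction rule: ideal_gen_induct)
         (use coeffs in \<open>auto intro: ideal_gen_0 ideal_gen_add ideal_gen_mult\<close>)
  qed
  have *: "Var i * Var j \<in> (double_point_ideal :: ('n, 'k) mpoly set)" for i j
    unfolding double_point_ideal_def by (rule ideal_gen_base) auto
  have gen: "arc_generator i j l \<in> arc_ideal (double_point_ideal :: ('n, 'k) mpoly set)" for i j l
    unfolding arc_ideal_def arc_subst_generator[symmetric] using * by (intro ideal_gen_base) blast
  show "?J \<subseteq> arc_ideal (double_point_ideal :: ('n, 'k) mpoly set)"
  proof
    fix p :: "('n \<times> nat, 'k) mpoly"
    assume "p \<in> ?J"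
    thus "p \<in> arc_ideal double_point_ideal"
      by (induction rule: ideal_gen_induct)
         (use gen in \<open>auto simp: arc_ideal_def intro: ideal_gen_0 ideal_gen_add ideal_gen_mult\<close>)
  qed
qed

definition arc_perp :: "('n::finite \<times> nat, 'k::field_char_0) mpoly set" where
  "arc_perp = inverse_system (arc_ideal double_point_ideal)"

lemma arc_perp_pairing:
  assumes "f \<in> arc_perp"
  shows "pairing f (q * arc_generator i j l) = 0"
proof -
  have "q * arc_generator i j l \<in> ideal_gen {arc_generator i j l | i j l. True}"
    by (intro ideal_gen_mult ideal_gen_base) auto
  thus ?thesis
    using assms unfolding arc_perp_def inverse_system_pairing arc_ideal_double_point by simp
qed

text \<open>By adjointness, a polynomial annihilated by the operators of all the generators is orthogonal to all
  their multiples, hence to the ideal.\<close>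

lemma arc_perpI:
  assumes "\<And>i j l. (\<Sum>s\<le>l. pdiff (j, l - s) (pdiff (i, s) f)) = 0"
  shows "f \<in> arc_perp"
proof -
  have 0: "pairing f (q * arc_generator i j l) = 0" for q i j l
  proof -
    have "pairing f (q * arc_generator i j l) =
        (\<Sum>s\<le>l. pairing f (Var (i, s) * (Var (j, l - s) * q)))"
      by (simp add: arc_generator_def sum_distrib_left pairing_sum_right mult_ac)
    also have "\<dots> = pairing (\<Sum>s\<le>l. pdiff (j, l - s) (pdiff (i, s) f)) q"
      by (simp add: pairing_Var_mult pairing_sum_left)
    also have "\<dots> = 0" by (simp add: assms)
    finally show ?thesis .
  qed
  have "\<forall>q. pairing f (q * p) = 0" if "p \<in> ideal_gen {arc_generator i j l | i j l. True}" for p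
    using that
  proof (induction rule: ideal_gen_induct)
    case (add p q)
    thus ?case by (simp add: distrib_left pairing_add_right)
  next
    case (mult p q)
    thus ?case by (simp flip: mult.assoc)
  qed (use 0 in auto)
  from this[THEN spec, of _ 1] show ?thesis
    by (simp add: arc_perp_def inverse_system_pairing arc_ideal_double_point)
qed

section \<open>Linear spans\<close>

lemma linear_span_subset:
  assumes "S \<subseteq> T" "0 \<in> T" "\<And>p q. p \<in> T \<Longrightarrow> q \<in> T \<Longrightarrow> p + q \<in> T"
    "\<And>c p. p \<in> T \<Longrightarrow> Const c * p \<in> T"
  shows "linear_span S \<subseteq> (T :: ('v, 'k::field) mpoly set)"
proof -
  interpret vector_space "\<lambda>c p. Const c * p :: ('v, 'k) mpoly" by (rule vector_space_mpoly)
  show ?thesis unfolding linear_span_def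
    by (rule span_minimal) (use assms in \<open>auto simp: subspace_def\<close>)
qed

lemma linear_span_base: "p \<in> S \<Longrightarrow> p \<in> linear_span (S :: ('v, 'k::field) mpoly set)"
proof -
  interpret vector_space "\<lambda>c p. Const c * p :: ('v, 'k) mpoly" by (rule vector_space_mpoly)
  show "p \<in> S \<Longrightarrow> p \<in> linear_span S" unfolding linear_span_def by (rule span_base)
qed

lemma linear_span_0: "0 \<in> linear_span (S :: ('v, 'k::field) mpoly set)"
proof -
  interpret vector_space "\<lambda>c p. Const c * p :: ('v, 'k) mpoly" by (rule vector_space_mpoly)
  show ?thesis unfolding linear_span_def by (rule span_zero)
qed

lemma linear_span_scale:
  assumes "p \<in> linear_span (S :: ('v, 'k::field) mpoly set)"
  shows "Const c * p \<in> linear_span S"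
proof -
  interpret vector_space "\<lambda>c p. Const c * p :: ('v, 'k) mpoly" by (rule vector_space_mpoly)
  show ?thesis using assms unfolding linear_span_def by (rule span_scale)
qed

lemma linear_span_sum:
  assumes "\<And>x. x \<in> A \<Longrightarrow> f x \<in> linear_span (S :: ('v, 'k::field) mpoly set)"
  shows "sum f A \<in> linear_span S"
proof -
  interpret vector_space "\<lambda>c p. Const c * p :: ('v, 'k) mpoly" by (rule vector_space_mpoly)
  show ?thesis using assms unfolding linear_span_def by (rule span_sum)
qed

section \<open>Wronskians of variables are orthogonal to the arc ideal\<close>

lemma derivation_funpow_Var: "(derivation ^^ r) (Var (i, j)) = Var (i, j + r)"
  by (induction r) auto

text \<open>In column \<open>a\<close>, row \<open>r\<close> of the matrix stands the variable with derivation order \<open>e a + r\<close>, so the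
  Leibniz formula for the determinant shifts the orders by the permutations.\<close>

lemma wronskian_Vars:
  "wronskian (map (\<lambda>a. Var (i a, e a)) [0..<d]) =
     (\<Sum>\<rho> | \<rho> permutes {0..<d}. signof \<rho> * (\<Prod>a<d. Var (i a, e a + \<rho> a)))"
proof -
  have "mat d d (\<lambda>(x, y). (derivation ^^ x) (map (\<lambda>a. Var (i a, e a)) [0..<d] ! y)) \<in> carrier_mat d d"
    by simp
  from det_col[OF this] show ?thesis unfolding wronskian_def
    by (auto simp: derivation_funpow_Var permutes_def intro!: sum.cong prod.cong)
qed

lemma pdiff_sum: "pdiff v (sum f A) = (\<Sum>x\<in>A. pdiff v (f x))"
  by (induction A rule: infinite_finite_induct) (auto simp: pdiff_add)

lemma pdiff_Var: "pdiff v (Var w) = (if v = w then 1 else 0)"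
  by (simp add: Var_def pdiff_monom lookup_single when_def)

lemma pdiff_1 [simp]: "pdiff v 1 = 0"
  using pdiff_monom[of v 0 1] by simp

lemma pdiff_signof: "pdiff v (signof \<rho> * p) = signof \<rho> * pdiff v p"
proof -
  have "pdiff v (- p) = - pdiff v p"
    using pdiff_add[of v p "- p"] by (simp add: eq_neg_iff_add_eq_0 add.commute)
  thus ?thesis by (auto simp: sign_def)
qed

lemma pdiff_prod_Var:
  assumes "finite A"
  shows "pdiff v (\<Prod>a\<in>A. Var (u a)) = (\<Sum>a\<in>A. if u a = v then \<Prod>b\<in>A-{a}. Var (u b) else 0)"
  using assms
proof induction
  case (insert x A)
  have 1: "(\<Sum>a\<in>A. if u a = v then \<Prod>b\<in>insert x A-{a}. Var (u b) else 0) =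
      (\<Sum>a\<in>A. Var (u x) * (if u a = v then \<Prod>b\<in>A-{a}. Var (u b) else 0))"
  proof (rule sum.cong)
    fix a assume "a \<in> A"
    hence "insert x A - {a} = insert x (A - {a})" using insert by auto
    thus "(if u a = v then \<Prod>b\<in>insert x A-{a}. Var (u b) else 0) =
        Var (u x) * (if u a = v then \<Prod>b\<in>A-{a}. Var (u b) else 0)"
      using insert by simp
  qed simp
  thus ?case
    using insert(1,2) by (simp add: pdiff_mult pdiff_Var sum_distrib_left insert(3) 1)
qed simp

lemma eq_uminus_self: "x = - x \<Longrightarrow> x = (0 :: ('v, 'k::field_char_0) mpoly)"
proof (rule poly_mapping_eqI)
  fix m assume "x = - x"
  hence "Poly_Mapping.lookup x m = - Poly_Mapping.lookup x m"
    by (metis lookup_uminus)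
  hence "2 * Poly_Mapping.lookup x m = 0" by (simp only: eq_neg_iff_add_eq_0 mult_2)
  thus "Poly_Mapping.lookup x m = Poly_Mapping.lookup 0 m" by simp
qed

text \<open>The operator of a generator picks two columns \<open>a\<close> and \<open>b\<close> and removes the entries chosen there by the
  permutation \<open>\<rho>\<close>; for given columns, whether it does so depends on \<open>\<rho>\<close> only via
  \<open>\<rho> a + \<rho> b\<close>. Exchanging the two values of \<open>\<rho>\<close> preserves that sum and the other factors but reverses the sign, so everything cancels.\<close>

lemma wronskian_Vars_in_arc_perp:
  fixes i :: "nat \<Rightarrow> 'n::finite" and e :: "nat \<Rightarrow> nat"
  shows "wronskian (map (\<lambda>a. Var (i a, e a)) [0..<d]) \<in> (arc_perp :: ('n \<times> nat, 'k::field_char_0) mpoly set)"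
proof (rule arc_perpI)
  fix k l :: 'n and n :: nat
  define P where "P = {\<rho>. \<rho> permutes {0..<d}}"
  define R :: "(nat \<Rightarrow> nat) \<Rightarrow> nat \<Rightarrow> nat \<Rightarrow> ('n \<times> nat, 'k) mpoly" where
    "R \<rho> a b = (if i a = k \<and> i b = l \<and> e a + \<rho> a + (e b + \<rho> b) = n
       then \<Prod>c\<in>{..<d}-{a}-{b}. Var (i c, e c + \<rho> c) else 0)" for \<rho> a b
  have inner: "(\<Sum>s\<le>n. pdiff (l, n - s) (pdiff (k, s) (\<Prod>a<d. Var (i a, e a + \<rho> a)))) =
      (\<Sum>a<d. \<Sum>b\<in>{..<d}-{a}. R \<rho> a b)" for \<rho>
  proof -
    have "(\<Sum>s\<le>n. pdiff (l, n - s) (pdiff (k, s) (\<Prod>a<d. Var (i a, e a + \<rho> a)))) =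
      (\<Sum>s\<le>n. \<Sum>a<d. \<Sum>b\<in>{..<d}-{a}. if (i a, e a + \<rho> a) = (k, s) \<and> (i b, e b + \<rho> b) = (l, n - s)
         then \<Prod>c\<in>{..<d}-{a}-{b}. Var (i c, e c + \<rho> c) else 0 :: ('n \<times> nat, 'k) mpoly)"
      by (auto simp: pdiff_prod_Var pdiff_sum intro!: sum.cong)
    also have "\<dots> = (\<Sum>a<d. \<Sum>b\<in>{..<d}-{a}. \<Sum>s\<le>n. if (i a, e a + \<rho> a) = (k, s) \<and> (i b, e b + \<rho> b) = (l, n - s)
         then \<Prod>c\<in>{..<d}-{a}-{b}. Var (i c, e c + \<rho> c) else 0 :: ('n \<times> nat, 'k) mpoly)"
      by (subst sum.swap, subst (2) sum.swap) simp
    also have "\<dots> = (\<Sum>a<d. \<Sum>b\<in>{..<d}-{a}. R \<rho> a b)"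
    proof (intro sum.cong refl)
      fix a b
      have "(\<Sum>s\<le>n. if (i a, e a + \<rho> a) = (k, s) \<and> (i b, e b + \<rho> b) = (l, n - s)
         then \<Prod>c\<in>{..<d}-{a}-{b}. Var (i c, e c + \<rho> c) else 0 :: ('n \<times> nat, 'k) mpoly) =
        (\<Sum>s\<le>n. if s = e a + \<rho> a then R \<rho> a b else 0)"
        by (rule sum.cong) (auto simp: R_def)
      also have "\<dots> = R \<rho> a b" by (auto simp: R_def)
      finally show "(\<Sum>s\<le>n. if (i a, e a + \<rho> a) = (k, s) \<and> (i b, e b + \<rho> b) = (l, n - s)
         then \<Prod>c\<in>{..<d}-{a}-{b}. Var (i c, e c + \<rho> c) else 0 :: ('n \<times> nat, 'k) mpoly) = R \<rho> a b" .
    qed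
    finally show ?thesis .
  qed
  have "(\<Sum>s\<le>n. pdiff (l, n - s) (pdiff (k, s) (wronskian (map (\<lambda>a. Var (i a, e a)) [0..<d])))) =
      (\<Sum>s\<le>n. \<Sum>\<rho>\<in>P. signof \<rho> * pdiff (l, n - s) (pdiff (k, s) (\<Prod>a<d. Var (i a, e a + \<rho> a))))"
    by (simp add: wronskian_Vars P_def pdiff_sum pdiff_signof)
  also have "\<dots> = (\<Sum>\<rho>\<in>P. signof \<rho> * (\<Sum>a<d. \<Sum>b\<in>{..<d}-{a}. R \<rho> a b))"
    by (subst sum.swap) (simp add: inner flip: sum_distrib_left)
  also have "\<dots> = (\<Sum>a<d. \<Sum>b\<in>{..<d}-{a}. \<Sum>\<rho>\<in>P. signof \<rho> * R \<rho> a b)"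
    by (simp add: sum_distrib_left) (subst sum.swap, subst (2) sum.swap, simp)
  also have "\<dots> = 0"
  proof (rule sum.neutral, rule ballI, rule sum.neutral, rule ballI)
    fix a b assume ab: "a \<in> {..<d}" "b \<in> {..<d} - {a}"
    let ?\<tau> = "Transposition.transpose a b"
    have \<tau>: "?\<tau> permutes {0..<d}" using ab by (intro permutes_swap_id) auto
    have inv: "\<rho> \<circ> ?\<tau> \<circ> ?\<tau> = \<rho>" for \<rho> :: "nat \<Rightarrow> nat"
      by (simp add: comp_assoc)
    have R: "R (\<rho> \<circ> ?\<tau>) a b = R \<rho> a b" for \<rho>
    proof -
      have "(\<Prod>c\<in>{..<d}-{a}-{b}. Var (i c, e c + (\<rho> \<circ> ?\<tau>) c) :: ('n \<times> nat, 'k) mpoly) =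
          (\<Prod>c\<in>{..<d}-{a}-{b}. Var (i c, e c + \<rho> c))"
        by (rule prod.cong) (auto simp: Transposition.transpose_def)
      thus ?thesis unfolding R_def by (simp add: add_ac)
    qed
    have sgn: "signof (\<rho> \<circ> ?\<tau>) = (- signof \<rho> :: ('n \<times> nat, 'k) mpoly)" if "\<rho> \<in> P" for \<rho>
    proof -
      have "sign (\<rho> \<circ> ?\<tau>) = sign \<rho> * sign ?\<tau>"
        using that \<tau> by (intro sign_compose) (auto simp: P_def permutation_permutes)
      thus ?thesis using ab by (simp add: sign_swap_id)
    qed
    have "(\<Sum>\<rho>\<in>P. signof \<rho> * R \<rho> a b) = (\<Sum>\<rho>\<in>P. - (signof \<rho> * R \<rho> a b))"
      by (rule sum.reindex_bij_witness[of _ "\<lambda>\<rho>. \<rho> \<circ> ?\<tau>" "\<lambda>\<rho>. \<rho> \<circ> ?\<tau>"])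
         (use \<tau> in \<open>auto simp: inv R sgn P_def intro: permutes_compose\<close>)
    thus "(\<Sum>\<rho>\<in>P. signof \<rho> * R \<rho> a b) = 0"
      by (intro eq_uminus_self) (simp only: sum_negf)
  qed
  finally show "(\<Sum>s\<le>n. pdiff (l, n - s) (pdiff (k, s) (wronskian (map (\<lambda>a. Var (i a, e a)) [0..<d])))) = (0 :: ('n \<times> nat, 'k) mpoly)" .
qed

section \<open>Vandermonde determinants\<close>

lemma det_scale_rows:
  fixes s :: "nat \<Rightarrow> 'a::comm_ring_1"
  shows "det (mat d d (\<lambda>(a, c). s a * M a c)) = (\<Prod>a<d. s a) * det (mat d d (\<lambda>(a, c). M a c))"
proof -
  have "(\<Prod>a = 0..<d. mat d d (\<lambda>(a, c). s a * M a c) $$ (a, p a)) =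
      (\<Prod>a<d. s a) * (\<Prod>a = 0..<d. mat d d (\<lambda>(a, c). M a c) $$ (a, p a))"
    if p: "p permutes {0..<d}" for p
  proof -
    have "p a < d" if "a < d" for a using that permutes_in_image[OF p, of a] by simp
    thus ?thesis
      by (simp add: prod.distrib atLeast0LessThan cong: prod.cong_simp)
  qed
  thus ?thesis
    by (simp add: det_def'[where n = d] sum_distrib_left mult.left_commute cong: sum.cong_simp)
qed

text \<open>Subtracting \<open>t\<^sub>0\<close> times each column from the next one, which is multiplication by a unipotent matrix,
  clears the first row except for its corner. Row \<open>a\<close> of the remaining minor is \<open>t\<^sub>a - t\<^sub>0\<close> times
  a row of the Vandermonde matrix of the other points.\<close>

lemma det_vandermonde:
  fixes t :: "nat \<Rightarrow> 'a::comm_ring_1"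
  shows "det (mat d d (\<lambda>(a, r). t a ^ r)) = (\<Prod>b<d. \<Prod>a<b. t b - t a)"
proof (induction d arbitrary: t)
  case 0
  show ?case by simp
next
  case (Suc d)
  define A where "A = mat (Suc d) (Suc d) (\<lambda>(a, r). t a ^ r)"
  define U where "U = mat (Suc d) (Suc d) (\<lambda>(r, c). if r = c then 1 else if Suc r = c then - t 0 else 0)"
  define B where "B = mat (Suc d) (Suc d) (\<lambda>(a, c). if c = 0 then 1 else (t a - t 0) * t a ^ (c - 1))"
  have carr: "A \<in> carrier_mat (Suc d) (Suc d)" "U \<in> carrier_mat (Suc d) (Suc d)"
    "B \<in> carrier_mat (Suc d) (Suc d)"
    by (simp_all add: A_def U_def B_def)
  have "A * U = B"
  proof (rule eq_matI)
    fix a c assume ac: "a < dim_row B" "c < dim_col B"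
    hence ac: "a < Suc d" "c < Suc d" by (simp_all add: B_def)
    have "(A * U) $$ (a, c) =
        (\<Sum>r<Suc d. t a ^ r * (if r = c then 1 else if Suc r = c then - t 0 else 0))"
      using ac by (simp add: A_def U_def scalar_prod_def atLeast0LessThan)
    also have "\<dots> = (\<Sum>r<Suc d. (if r = c then t a ^ c else 0) +
        (if 0 < c \<and> r = c - 1 then - t 0 * t a ^ (c - 1) else 0))"
      by (rule sum.cong) auto
    also have "\<dots> = t a ^ c + (if 0 < c then - t 0 * t a ^ (c - 1) else 0)"
      using ac by (auto simp: sum.distrib)
    also have "\<dots> = B $$ (a, c)"
      using ac by (cases c) (auto simp: B_def algebra_simps)
    finally show "(A * U) $$ (a, c) = B $$ (a, c)" .
  qed (simp_all add: A_def U_def B_def)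
  moreover have "det U = 1"
  proof -
    have "diag_mat U = map (\<lambda>_. 1) [0..<Suc d]"
      by (auto simp: diag_mat_def U_def simp del: upt_Suc)
    moreover have "prod_list (map (\<lambda>_. 1) xs) = (1::'a)" for xs :: "nat list"
      by (induction xs) auto
    moreover have "upper_triangular U" by (auto simp: U_def upper_triangular_def)
    ultimately show ?thesis
      using det_upper_triangular[of U "Suc d"] carr by (simp del: upt_Suc)
  qed
  ultimately have "det A = det B"
    using det_mult[OF carr(1,2)] by simp
  also have "\<dots> = (\<Sum>j<Suc d. B $$ (0, j) * cofactor B 0 j)"
    using carr by (intro laplace_expansion_row) auto
  also have "\<dots> = (\<Sum>j<Suc d. if j = 0 then cofactor B 0 0 else 0)"
    by (rule sum.cong) (auto simp: B_def)
  also have "\<dots> = det (mat_delete B 0 0)" by (simp add: cofactor_def)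
  also have "mat_delete B 0 0 = mat d d (\<lambda>(a, c). (t (Suc a) - t 0) * t (Suc a) ^ c)"
    by (rule eq_matI) (auto simp: B_def mat_delete_def)
  also have "det \<dots> = (\<Prod>a<d. t (Suc a) - t 0) * (\<Prod>b<d. \<Prod>a<b. t (Suc b) - t (Suc a))"
    by (simp add: det_scale_rows Suc)
  also have "\<dots> = (\<Prod>b<Suc d. \<Prod>a<b. t b - t a)"
    by (simp add: prod.lessThan_Suc_shift prod.distrib del: prod.lessThan_Suc)
  finally show ?case by (simp add: A_def)
qed

section \<open>Polynomials vanishing on the diagonals\<close>

definition merge_vars :: "'v \<Rightarrow> 'v \<Rightarrow> ('v \<Rightarrow>\<^sub>0 nat) \<Rightarrow> ('v \<Rightarrow>\<^sub>0 nat)" where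
  "merge_vars a b m = m - Poly_Mapping.single b (Poly_Mapping.lookup m b) +
     Poly_Mapping.single a (Poly_Mapping.lookup m b)"

lemma lookup_merge_vars:
  "a \<noteq> b \<Longrightarrow> Poly_Mapping.lookup (merge_vars a b m) x =
     (if x = b then 0 else if x = a then Poly_Mapping.lookup m a + Poly_Mapping.lookup m b
      else Poly_Mapping.lookup m x)"
  by (auto simp: merge_vars_def lookup_add lookup_minus lookup_single when_def)

lemma merge_vars_add:
  "a \<noteq> b \<Longrightarrow> merge_vars a b (m + n) = merge_vars a b m + merge_vars a b n"
  by (rule poly_mapping_eqI) (simp add: lookup_merge_vars lookup_add)

text \<open>The substitution of \<open>a\<close> for the variable \<open>b\<close>.\<close>

definition identify :: "'v \<Rightarrow> 'v \<Rightarrow> ('v, 'k::comm_ring_1) mpoly \<Rightarrow> ('v, 'k) mpoly" where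
  "identify a b p = (\<Sum>m\<in>Poly_Mapping.keys p.
     Poly_Mapping.single (merge_vars a b m) (Poly_Mapping.lookup p m))"

lemma identify_superset:
  assumes "finite A" "Poly_Mapping.keys p \<subseteq> A"
  shows "identify a b p = (\<Sum>m\<in>A. Poly_Mapping.single (merge_vars a b m) (Poly_Mapping.lookup p m))"
  unfolding identify_def by (rule sum.mono_neutral_left) (use assms in \<open>auto simp: in_keys_iff\<close>)

lemma identify_monom:
  "identify a b (Poly_Mapping.single m c) = Poly_Mapping.single (merge_vars a b m) c"
  by (subst identify_superset[of "{m}"]) auto

lemma identify_add: "identify a b (p + q) = identify a b p + identify a b q"
  using keys_add[of p q]
  by (simp add: identify_superset[of "Poly_Mapping.keys p \<union> Poly_Mapping.keys q"] lookup_add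
      single_add sum.distrib)

lemma identify_minus: "identify a b (p - q) = identify a b p - identify a b q"
  using identify_add[of a b "p - q" q] by (simp add: algebra_simps)

lemma identify_mult:
  assumes "a \<noteq> b"
  shows "identify a b (p * q) = identify a b p * identify a b q"
proof (induction p rule: mpoly_induct)
  case (monom m c)
  show ?case
    by (induction q rule: mpoly_induct)
       (simp_all add: mult_single identify_monom merge_vars_add[OF assms] identify_add distrib_left)
qed (simp add: identify_add distrib_right)

lemma identify_Var:
  assumes "a \<noteq> b"
  shows "identify a b (Var v) = Var (if v = b then a else v)"
proof -
  have "merge_vars a b (vmon v) = vmon (if v = b then a else v)"
    using assms
    by (intro poly_mapping_eqI) (auto simp: lookup_merge_vars lookup_single when_def)
  thus ?thesis by (simp add: Var_def identify_monom)
qed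

lemma Var_power: "Var v ^ n = Poly_Mapping.single (Poly_Mapping.single v n) 1"
  by (induction n) (simp_all add: Var_def mult_single flip: single_add)

text \<open>Each monomial changes by a multiple of \<open>y\<^sub>b^n - y\<^sub>a^n\<close>, where \<open>y\<^sub>v\<close> is the variable \<open>v\<close>. In particular the
  kernel of the substitution is generated by \<open>y\<^sub>b - y\<^sub>a\<close>.\<close>

lemma diff_dvd_minus_identify:
  assumes "a \<noteq> b"
  shows "Var b - Var a dvd p - identify a b p"
proof (induction p rule: mpoly_induct)
  case (monom m c)
  define n where "n = Poly_Mapping.lookup m b"
  define m' where "m' = m - Poly_Mapping.single b n"
  have m: "m = m' + Poly_Mapping.single b n"
    by (rule poly_mapping_eqI) (auto simp: m'_def n_def lookup_add lookup_minus lookup_single when_def)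
  have 1: "Poly_Mapping.single m c = Poly_Mapping.single m' c * Var b ^ n"
    by (subst m) (simp add: Var_power mult_single)
  have 2: "identify a b (Poly_Mapping.single m c) = Poly_Mapping.single m' c * Var a ^ n"
    by (simp add: identify_monom merge_vars_def Var_power mult_single m'_def n_def)
  have "Poly_Mapping.single m c - identify a b (Poly_Mapping.single m c) =
      Poly_Mapping.single m' c * (Var b ^ n - Var a ^ n)"
    unfolding 1[symmetric] 2 by (subst 1) (simp only: right_diff_distrib)
  moreover have "Var b - Var a dvd (Var b ^ n - Var a ^ n :: ('a, 'b) mpoly)"
    by (metis dvd_triv_left power_diff_sumr2)
  ultimately show ?case by simp
next
  case (add p q)
  have "p + q - identify a b (p + q) = (p - identify a b p) + (q - identify a b q)"
    by (simp add: identify_add)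
  thus ?case using add by (metis dvd_add)
qed

lemma Var_eq_iff [simp]: "(Var v :: ('v, 'k::comm_ring_1) mpoly) = Var w \<longleftrightarrow> v = w"
proof
  assume *: "(Var v :: ('v, 'k::comm_ring_1) mpoly) = Var w"
  have "Poly_Mapping.keys (Var v :: ('v, 'k) mpoly) = {vmon v}" for v
    by (simp add: Var_def)
  hence "vmon v = vmon w" using * by (metis singleton_inject)
  hence "Poly_Mapping.keys (vmon v) = Poly_Mapping.keys (vmon w)" by simp
  thus "v = w" by simp
qed simp

text \<open>A polynomial vanishing on each of several hyperplanes \<open>y\<^sub>a = y\<^sub>b\<close> is divisible by the product of their
  equations. One factor is split off at a time: a different difference \<open>y\<^sub>d - y\<^sub>c\<close> does not vanish
  on \<open>y\<^sub>a = y\<^sub>b\<close>, so, the ring being a domain, the quotient still vanishes there.\<close>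

lemma prod_differences_dvd:
  fixes F :: "(nat, 'k::field) mpoly"
  assumes "finite P" "\<And>a b. (a, b) \<in> P \<Longrightarrow> a < b \<and> identify a b F = 0"
  shows "(\<Prod>(a, b)\<in>P. Var b - Var a) dvd F"
  using assms
proof (induction P)
  case (insert x P)
  obtain a b where x: "x = (a, b)" by (cases x)
  have ab: "a < b" "identify a b F = 0" using insert.prems[of a b] x by auto
  hence neq: "a \<noteq> b" by simp
  note prems = insert.prems insert.hyps
  let ?D = "\<lambda>P. (\<Prod>(a, b)\<in>P. Var b - Var a) :: (nat, 'k) mpoly"
  have "?D P dvd F" using insert by blast
  then obtain Q where F: "F = ?D P * Q" by blast
  have "identify a b (?D P') \<noteq> 0" if "finite P'" "P' \<subseteq> P" for P'
    using that
  proof (induction P')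
    case empty
    have "identify a b (1 :: (nat, 'k) mpoly) = 1"
      using identify_monom[of a b 0 1] by (simp add: merge_vars_def)
    thus ?case by simp
  next
    case (insert y P')
    obtain c d where y: "y = (c, d)" by (cases y)
    have "(c, d) \<noteq> (a, b)" "c < d"
      using insert.prems x y prems by auto
    hence "(if d = b then a else d) \<noteq> (if c = b then a else c)"
      using ab by auto
    hence "identify a b (Var d - Var c :: (nat, 'k) mpoly) \<noteq> 0"
      by (simp add: identify_minus identify_Var[OF neq])
    thus ?case using insert y by (simp add: identify_mult[OF neq])
  qed
  hence "identify a b (?D P) \<noteq> 0" using insert by blast
  moreover have "identify a b (?D P) * identify a b Q = 0"
    using ab F by (simp add: identify_mult[OF neq])
  ultimately have "identify a b Q = 0" by simp
  hence "Var b - Var a dvd Q" using diff_dvd_minus_identify[OF neq, of Q] by simp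
  hence "(Var b - Var a) * ?D P dvd Q * ?D P" by (rule mult_dvd_mono) simp
  thus ?case using insert x F by (simp add: mult.commute)
qed simp

section \<open>Taylor expansion over sequences of variables\<close>

lemma pairing_prod_Var_eq_0:
  assumes "finite A" "a \<in> A" "u a \<notin> vars f"
  shows "pairing f (\<Prod>a\<in>A. Var (u a)) = 0"
proof -
  have "pairing f (\<Prod>a\<in>A. Var (u a)) = pairing (pdiff (u a) f) (\<Prod>a\<in>A-{a}. Var (u a))"
    using assms by (simp add: prod.remove pairing_Var_mult)
  thus ?thesis using assms by (simp add: pdiff_eq_0)
qed

text \<open>For \<open>A \<supseteq> vars f\<close> this is \<open>d!\<close> times the homogeneous component of degree \<open>d\<close> of \<open>f\<close>: the sum of
  the \<open>d\<close>-th order partial derivatives at \<open>0\<close>, each times its monomial, over all sequences of \<open>d\<close> variables.\<close>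

definition taylor_part :: "'v set \<Rightarrow> nat \<Rightarrow> ('v, 'k::field_char_0) mpoly \<Rightarrow> ('v, 'k) mpoly" where
  "taylor_part A d f = (\<Sum>u\<in>{..<d} \<rightarrow>\<^sub>E A. Const (pairing f (\<Prod>a<d. Var (u a))) * (\<Prod>a<d. Var (u a)))"

lemma Const_0 [simp]: "Const 0 = 0"
  by (simp add: Const_def)

lemma taylor_part_0 [simp]: "taylor_part A d 0 = 0"
  by (simp add: taylor_part_def)

lemma taylor_part_add: "taylor_part A d (f + g) = taylor_part A d f + taylor_part A d g"
  by (simp add: taylor_part_def pairing_add_left Const_add distrib_right sum.distrib)

lemma taylor_part_sum: "taylor_part A d (sum f B) = (\<Sum>x\<in>B. taylor_part A d (f x))"
  by (induction B rule: infinite_finite_induct) (auto simp: taylor_part_add)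

lemma taylor_part_Suc:
  "taylor_part A (Suc d) f = (\<Sum>y\<in>A. Var y * taylor_part A d (pdiff y f))"
proof -
  have *: "(\<Prod>a<d. Var (if a = d then y else g a)) = (\<Prod>a<d. Var (g a))" for g :: "nat \<Rightarrow> 'a" and y
    by (rule prod.cong) auto
  have "taylor_part A (Suc d) f = (\<Sum>(y, g)\<in>A \<times> ({..<d} \<rightarrow>\<^sub>E A).
      Const (pairing f (Var y * (\<Prod>a<d. Var (g a)))) * (Var y * (\<Prod>a<d. Var (g a))))"
    unfolding taylor_part_def lessThan_Suc PiE_insert_eq
    by (subst sum.reindex[OF inj_combinator]) (simp_all add: * case_prod_unfold)
  also have "\<dots> = (\<Sum>y\<in>A. \<Sum>g\<in>{..<d} \<rightarrow>\<^sub>E A.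
      Const (pairing f (Var y * (\<Prod>a<d. Var (g a)))) * (Var y * (\<Prod>a<d. Var (g a))))"
    by (rule sum.cartesian_product[symmetric])
  also have "\<dots> = (\<Sum>y\<in>A. Var y * taylor_part A d (pdiff y f))"
    by (simp add: taylor_part_def sum_distrib_left pairing_Var_mult mult_ac)
  finally show ?thesis .
qed

text \<open>Iteration of Euler's identity: the sum of the \<open>y \<partial>f/\<partial>y\<close> over all variables
  \<open>y\<close> is \<open>deg f\<close> times a homogeneous \<open>f\<close>.\<close>

lemma taylor_part_monom:
  fixes c :: "'k::field_char_0"
  assumes "finite A" "Poly_Mapping.keys m \<subseteq> A"
  shows "taylor_part A d (Poly_Mapping.single m c) =
    (if (\<Sum>v\<in>A. Poly_Mapping.lookup m v) = d then Poly_Mapping.single m (fact d * c) else 0)"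
  using assms(2)
proof (induction d arbitrary: m c)
  case 0
  have "Poly_Mapping.lookup (Poly_Mapping.single m c) 0 =
      (if (\<Sum>v\<in>A. Poly_Mapping.lookup m v) = 0 then c else 0)"
  proof -
    have "(\<Sum>v\<in>A. Poly_Mapping.lookup m v) = 0 \<longleftrightarrow> m = 0"
    proof
      assume "(\<Sum>v\<in>A. Poly_Mapping.lookup m v) = 0"
      hence "Poly_Mapping.lookup m v = 0" for v
        using assms 0 by (cases "v \<in> A") (auto simp: in_keys_iff)
      thus "m = 0" by (intro poly_mapping_eqI) simp
    qed simp
    thus ?thesis by (auto simp: lookup_single when_def)
  qed
  moreover have "m = 0" if "(\<Sum>v\<in>A. Poly_Mapping.lookup m v) = 0"
  proof (rule poly_mapping_eqI)
    fix v show "Poly_Mapping.lookup m v = Poly_Mapping.lookup 0 v"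
      using that assms 0 by (cases "v \<in> A") (auto simp: in_keys_iff)
  qed
  ultimately show ?case
    by (auto simp: taylor_part_def pairing_1_right Const_def)
next
  case (Suc d)
  let ?deg = "\<lambda>m. \<Sum>v\<in>A. Poly_Mapping.lookup m v"
  have step: "Var y * taylor_part A d (pdiff y (Poly_Mapping.single m c)) =
      (if ?deg m = Suc d
       then Poly_Mapping.single m (fact d * (of_nat (Poly_Mapping.lookup m y) * c)) else 0)"
    if y: "y \<in> A" for y
  proof (cases "Poly_Mapping.lookup m y = 0")
    case True
    thus ?thesis by (simp add: pdiff_monom)
  next
    case False
    have "Poly_Mapping.keys (m - vmon y) \<subseteq> A"
      using Suc.prems by (auto simp: in_keys_iff lookup_minus)
    note IH = Suc.IH[OF this]
    have "?deg m = ?deg (vmon y + (m - vmon y))"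
      by (simp only: monomial_split_var[OF False])
    also have "\<dots> = 1 + ?deg (m - vmon y)"
      using assms(1) y by (simp add: lookup_add sum.distrib lookup_single when_def)
    finally have deg: "?deg m = Suc (?deg (m - vmon y))" by simp
    have "Var y * Poly_Mapping.single (m - vmon y) x = Poly_Mapping.single m x" for x :: 'k
      unfolding Var_def mult_single monomial_split_var[OF False] by simp
    thus ?thesis unfolding pdiff_monom IH deg by simp
  qed
  have "taylor_part A (Suc d) (Poly_Mapping.single m c) =
      (\<Sum>y\<in>A. if ?deg m = Suc d
       then Poly_Mapping.single m (fact d * (of_nat (Poly_Mapping.lookup m y) * c)) else 0)"
    unfolding taylor_part_Suc by (intro sum.cong refl step)
  also have "\<dots> = (if ?deg m = Suc d then
      Poly_Mapping.single m (\<Sum>y\<in>A. fact d * (of_nat (Poly_Mapping.lookup m y) * c)) else 0)"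
  proof -
    have "(\<Sum>y\<in>A. Poly_Mapping.single m (h y)) = Poly_Mapping.single m (sum h A)" for h :: "'a \<Rightarrow> 'k"
      by (induction A rule: infinite_finite_induct) (auto simp: single_add)
    thus ?thesis by simp
  qed
  also have "(\<Sum>y\<in>A. fact d * (of_nat (Poly_Mapping.lookup m y) * c)) = fact d * (of_nat (?deg m) * c)"
    by (simp add: sum_distrib_left sum_distrib_right)
  finally show ?case by (auto simp: algebra_simps)
qed

lemma taylor_expansion:
  fixes f :: "('v, 'k::field_char_0) mpoly"
  assumes "finite A" "vars f \<subseteq> A"
  obtains N where "f = (\<Sum>d\<le>N. Const (inverse (fact d)) * taylor_part A d f)"
proof
  define deg where "deg m = (\<Sum>v\<in>A. Poly_Mapping.lookup m v)" for m :: "'v \<Rightarrow>\<^sub>0 nat"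
  define N where "N = (\<Sum>m\<in>Poly_Mapping.keys f. deg m)"
  let ?m = "\<lambda>m. Poly_Mapping.single m (Poly_Mapping.lookup f m)"
  have monom: "(\<Sum>d\<le>N. Const (inverse (fact d)) * taylor_part A d (?m m)) = ?m m"
    if m: "m \<in> Poly_Mapping.keys f" for m
  proof -
    have "deg m \<le> N" unfolding N_def using m by (intro member_le_sum) auto
    have "Poly_Mapping.keys m \<subseteq> A" using m assms(2) by (auto simp: vars_def)
    hence "(\<Sum>d\<le>N. Const (inverse (fact d)) * taylor_part A d (?m m)) =
        (\<Sum>d\<le>N. if d = deg m then ?m m else 0)"
      by (intro sum.cong) (auto simp: taylor_part_monom[OF assms(1)] deg_def Const_single simp flip: mult.assoc)
    thus ?thesis using \<open>deg m \<le> N\<close> by simp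
  qed
  have "(\<Sum>d\<le>N. Const (inverse (fact d)) * taylor_part A d f) =
      (\<Sum>d\<le>N. \<Sum>m\<in>Poly_Mapping.keys f. Const (inverse (fact d)) * taylor_part A d (?m m))"
    by (subst mpoly_sum_monoms[of f]) (simp add: taylor_part_sum sum_distrib_left)
  also have "\<dots> = (\<Sum>m\<in>Poly_Mapping.keys f. ?m m)"
    by (subst sum.swap) (simp add: monom)
  finally show "f = (\<Sum>d\<le>N. Const (inverse (fact d)) * taylor_part A d f)"
    by (simp flip: mpoly_sum_monoms)
qed

section \<open>Multiples of the Vandermonde polynomial give Wronskians\<close>

definition coloured :: "nat \<Rightarrow> (nat \<Rightarrow> 'n) \<Rightarrow> (nat \<Rightarrow>\<^sub>0 nat) \<Rightarrow> ('n \<times> nat, 'k::comm_ring_1) mpoly" where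
  "coloured d i e = (\<Prod>a<d. Var (i a, Poly_Mapping.lookup e a))"

text \<open>The monomial \<open>y\<^sub>0^e\<^sub>0 \<cdots> y\<^sub>d\<^sub>-\<^sub>1^e\<^sub>d\<^sub>-\<^sub>1\<close> becomes the product of the arc variables of colours
  \<open>i 0, \<dots>, i (d-1)\<close> and orders \<open>e\<^sub>0, \<dots>, e\<^sub>d\<^sub>-\<^sub>1\<close>: exponents turn into orders of derivation. This map is linear,
  not multiplicative.\<close>

definition umbral :: "nat \<Rightarrow> (nat \<Rightarrow> 'n) \<Rightarrow> (nat, 'k::comm_ring_1) mpoly \<Rightarrow> ('n \<times> nat, 'k) mpoly" where
  "umbral d i p = (\<Sum>e\<in>Poly_Mapping.keys p. Const (Poly_Mapping.lookup p e) * coloured d i e)"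

lemma umbral_superset:
  assumes "finite A" "Poly_Mapping.keys p \<subseteq> A"
  shows "umbral d i p = (\<Sum>e\<in>A. Const (Poly_Mapping.lookup p e) * coloured d i e)"
  unfolding umbral_def by (rule sum.mono_neutral_left) (use assms in \<open>auto simp: in_keys_iff\<close>)

lemma umbral_0 [simp]: "umbral d i 0 = 0"
  by (simp add: umbral_def)

lemma umbral_monom: "umbral d i (Poly_Mapping.single e c) = Const c * coloured d i e"
  by (subst umbral_superset[of "{e}"]) auto

lemma umbral_add: "umbral d i (p + q) = umbral d i p + umbral d i q"
  using keys_add[of p q]
  by (simp add: umbral_superset[of "Poly_Mapping.keys p \<union> Poly_Mapping.keys q"] lookup_add
      Const_add distrib_right sum.distrib)

lemma umbral_sum: "umbral d i (sum p A) = (\<Sum>x\<in>A. umbral d i (p x))"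
  by (induction A rule: infinite_finite_induct) (auto simp: umbral_add)

lemma umbral_signof: "umbral d i (signof \<rho> * p) = signof \<rho> * umbral d i p"
proof -
  have "umbral d i (- p) = - umbral d i p"
    using umbral_add[of d i p "- p"] by (simp add: eq_neg_iff_add_eq_0 add.commute)
  thus ?thesis by (auto simp: sign_def)
qed

definition vandermonde :: "nat \<Rightarrow> (nat, 'k::comm_ring_1) mpoly" where
  "vandermonde d = (\<Prod>b<d. \<Prod>a<b. Var b - Var a)"

definition exponents :: "nat \<Rightarrow> (nat \<Rightarrow> nat) \<Rightarrow> (nat \<Rightarrow>\<^sub>0 nat)" where
  "exponents d n = (\<Sum>a<d. Poly_Mapping.single a (n a))"

lemma lookup_exponents: "Poly_Mapping.lookup (exponents d n) a = (if a < d then n a else 0)"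
  by (simp add: exponents_def lookup_sum lookup_single when_def)

lemma prod_Var_power: "(\<Prod>a<d. Var a ^ n a) = Poly_Mapping.single (exponents d n) 1"
  by (induction d) (simp_all add: exponents_def Var_power mult_single add.commute)

lemma vandermonde_leibniz:
  "vandermonde d = (\<Sum>\<rho> | \<rho> permutes {0..<d}. signof \<rho> * Poly_Mapping.single (exponents d \<rho>) 1)"
proof -
  have "vandermonde d = det (mat d d (\<lambda>(a, r). Var a ^ r))"
    by (simp add: vandermonde_def det_vandermonde)
  also have "\<dots> = (\<Sum>\<rho> | \<rho> permutes {0..<d}. signof \<rho> * (\<Prod>a<d. Var a ^ \<rho> a))"
  proof -
    have "(\<Prod>a = 0..<d. mat d d (\<lambda>(a, r). Var a ^ r) $$ (a, \<rho> a)) = (\<Prod>a<d. Var a ^ \<rho> a)"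
      if p: "\<rho> permutes {0..<d}" for \<rho>
    proof -
      have "\<rho> a < d" if "a < d" for a using that permutes_in_image[OF p, of a] by simp
      thus ?thesis by (simp add: atLeast0LessThan cong: prod.cong_simp)
    qed
    thus ?thesis by (simp add: det_def'[where n = d] atLeast0LessThan)
  qed
  finally show ?thesis by (simp add: prod_Var_power)
qed

text \<open>Multiplying by the Vandermonde polynomial shifts the exponents by all permutations, with signs. The
  Wronskian of variables does precisely this to their orders.\<close>

lemma umbral_vandermonde_monom:
  fixes c :: "'k::comm_ring_1" and i :: "nat \<Rightarrow> 'n"
  shows "umbral d i (vandermonde d * Poly_Mapping.single e c) =
     Const c * wronskian (map (\<lambda>a. Var (i a, Poly_Mapping.lookup e a)) [0..<d])"
proof -
  have "coloured d i (exponents d \<rho> + e) =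
      (\<Prod>a<d. Var (i a, Poly_Mapping.lookup e a + \<rho> a) :: ('n \<times> nat, 'k) mpoly)" for \<rho>
    by (simp add: coloured_def lookup_add lookup_exponents add.commute)
  thus ?thesis
    by (simp add: vandermonde_leibniz sum_distrib_right umbral_sum mult.assoc mult_single
        umbral_signof umbral_monom wronskian_Vars sum_distrib_left mult.left_commute)
qed

lemma wronskian_not_distinct:
  assumes "\<not> distinct fs"
  shows "wronskian fs = 0"
proof -
  obtain a b where ab: "a < length fs" "b < length fs" "a \<noteq> b" "fs ! a = fs ! b"
    using assms by (auto simp: distinct_conv_nth)
  show ?thesis unfolding wronskian_def
    by (rule det_identical_columns[where n = "length fs" and i = a and j = b])
       (use ab in \<open>auto simp: col_def\<close>)
qed

abbreviation wronskians :: "('n \<times> nat, 'k::field_char_0) mpoly set" where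
  "wronskians \<equiv> (\<Union>S\<in>{S. finite S \<and> S \<subseteq> range Var}. set_wronskians S)"

text \<open>A list with repetitions does not come from a set, but its Wronskian is zero.\<close>

lemma wronskian_Vars_in_span:
  "wronskian (map (\<lambda>a. Var (i a, e a)) [0..<d]) \<in> linear_span wronskians"
proof (cases "distinct (map (\<lambda>a. Var (i a, e a)) [0..<d] :: ('a \<times> nat, 'b) mpoly list)")
  case True
  let ?fs = "map (\<lambda>a. Var (i a, e a)) [0..<d] :: ('a \<times> nat, 'b) mpoly list"
  have "wronskian ?fs \<in> set_wronskians (set ?fs)"
    using True by (auto simp: set_wronskians_def)
  moreover have "finite (set ?fs)" "set ?fs \<subseteq> range Var" by auto
  ultimately show ?thesis by (intro linear_span_base) blast
next
  case False
  thus ?thesis by (simp add: wronskian_not_distinct linear_span_0)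
qed

lemma umbral_vandermonde_in_span:
  "umbral d i (vandermonde d * p) \<in> linear_span wronskians"
proof -
  have "vandermonde d * p = (\<Sum>m\<in>Poly_Mapping.keys p.
      vandermonde d * Poly_Mapping.single m (Poly_Mapping.lookup p m))"
    by (subst mpoly_sum_monoms[of p]) (simp add: sum_distrib_left)
  thus ?thesis
    by (simp add: umbral_sum umbral_vandermonde_monom wronskian_Vars_in_span linear_span_scale
        linear_span_sum)
qed

section \<open>Generating polynomials of orthogonal elements\<close>

text \<open>A sequence of variables containing one that is absent from \<open>f\<close> pairs to zero with \<open>f\<close>.\<close>

lemma finite_generating_poly_support:
  "finite {e. (if Poly_Mapping.keys e \<subseteq> {..<d} then pairing f (coloured d i e) else 0) \<noteq> 0}"
    (is "finite ?S")
proof -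
  have "?S \<subseteq> exponents d ` ({..<d} \<rightarrow>\<^sub>E snd ` vars f)"
  proof
    fix e assume "e \<in> ?S"
    hence e: "Poly_Mapping.keys e \<subseteq> {..<d}" "pairing f (coloured d i e) \<noteq> 0"
      by (auto split: if_splits)
    have "Poly_Mapping.lookup e a \<in> snd ` vars f" if "a < d" for a
    proof -
      have "(i a, Poly_Mapping.lookup e a) \<in> vars f"
        using pairing_prod_Var_eq_0[of "{..<d}" a "\<lambda>a. (i a, Poly_Mapping.lookup e a)" f] e(2) that
        unfolding coloured_def by blast
      thus ?thesis by force
    qed
    moreover have "e = exponents d (restrict (Poly_Mapping.lookup e) {..<d})"
      using e(1) by (intro poly_mapping_eqI) (auto simp: lookup_exponents in_keys_iff)
    ultimately show "e \<in> exponents d ` ({..<d} \<rightarrow>\<^sub>E snd ` vars f)"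
      by (intro image_eqI[where x = "restrict (Poly_Mapping.lookup e) {..<d}"]) auto
  qed
  thus ?thesis by (rule finite_subset) (auto intro!: finite_PiE)
qed

text \<open>In terms of the power series \<open>x\<^sub>i(y) = \<Sum>\<^sub>s x\<^sub>i\<^sup>(\<^sup>s\<^sup>) y^s\<close>, this is the pairing of \<open>f\<close>
  with \<open>x\<^sub>i\<^sub>0(y\<^sub>0) \<cdots> x\<^sub>i\<^sub>d\<^sub>-\<^sub>1(y\<^sub>d\<^sub>-\<^sub>1)\<close>, coefficient by coefficient in the \<open>y\<close>'s.\<close>

definition generating_poly :: "('n \<times> nat, 'k::field_char_0) mpoly \<Rightarrow> nat \<Rightarrow> (nat \<Rightarrow> 'n) \<Rightarrow> (nat, 'k) mpoly" where
  "generating_poly f d i = Abs_poly_mapping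
     (\<lambda>e. if Poly_Mapping.keys e \<subseteq> {..<d} then pairing f (coloured d i e) else 0)"

lemma lookup_generating_poly:
  "Poly_Mapping.lookup (generating_poly f d i) e =
     (if Poly_Mapping.keys e \<subseteq> {..<d} then pairing f (coloured d i e) else 0)"
  unfolding generating_poly_def by (subst lookup_Abs_poly_mapping[OF finite_generating_poly_support]) simp

lemma lookup_identify:
  "Poly_Mapping.lookup (identify a b p) m =
     (\<Sum>e | e \<in> Poly_Mapping.keys p \<and> merge_vars a b e = m. Poly_Mapping.lookup p e)"
  by (simp add: identify_def lookup_sum lookup_single when_def sum.inter_filter)

text \<open>For \<open>y\<^sub>a = y\<^sub>b\<close> the product of power series contains the factor \<open>x\<^sub>k(y\<^sub>a) x\<^sub>l(y\<^sub>a)\<close>, with \<open>k\<close> and \<open>l\<close> the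
  colours at \<open>a\<close> and \<open>b\<close>. Its coefficients are generators of the arc ideal, and \<open>f\<close> is orthogonal
  to their multiples.\<close>

lemma identify_generating_poly:
  fixes f :: "('n::finite \<times> nat, 'k::field_char_0) mpoly"
  assumes f: "f \<in> arc_perp" and ab: "a \<noteq> b" "a < d" "b < d"
  shows "identify a b (generating_poly f d i) = 0"
proof (rule poly_mapping_eqI)
  fix m :: "nat \<Rightarrow>\<^sub>0 nat"
  let ?F = "generating_poly f d i"
  let ?S = "{e \<in> Poly_Mapping.keys ?F. merge_vars a b e = m}"
  have "(\<Sum>e\<in>?S. Poly_Mapping.lookup ?F e) = 0"
  proof (cases "Poly_Mapping.lookup m b = 0")
    case False
    hence "?S = {}" using ab(1) by (auto simp: lookup_merge_vars)
    thus ?thesis by (simp only: sum.empty)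
  next
    case True
    define n where "n = Poly_Mapping.lookup m a"
    \<comment> \<open>The monomials that become \<open>m\<close> under the identification: its exponent \<open>n\<close> at \<open>a\<close> is split into \<open>s\<close> and \<open>n - s\<close>.\<close>
    define g where "g s = m - Poly_Mapping.single a n + Poly_Mapping.single a s +
      Poly_Mapping.single b (n - s)" for s
    have g: "Poly_Mapping.lookup (g s) x = (if x = a then s else if x = b then n - s
        else Poly_Mapping.lookup m x)" for s x
      using ab(1) True by (auto simp: g_def n_def lookup_add lookup_minus lookup_single when_def)
    have inj: "inj_on g {..n}"
    proof
      fix s s' assume "g s = g s'"
      hence "Poly_Mapping.lookup (g s) a = Poly_Mapping.lookup (g s') a" by simp
      thus "s = s'" by (simp add: g)
    qed
    have sub: "?S \<subseteq> g ` {..n}"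
    proof
      fix e assume "e \<in> ?S"
      hence m: "m = merge_vars a b e" by simp
      have "e = g (Poly_Mapping.lookup e a)"
        using ab(1) by (intro poly_mapping_eqI) (auto simp: g n_def m lookup_merge_vars)
      moreover have "Poly_Mapping.lookup e a \<le> n"
        using ab(1) by (simp add: n_def m lookup_merge_vars)
      ultimately show "e \<in> g ` {..n}" by blast
    qed
    have merge_g: "merge_vars a b (g s) = m" if "s \<le> n" for s
      using ab(1) that True by (intro poly_mapping_eqI) (auto simp: lookup_merge_vars g n_def)
    have "(\<Sum>e\<in>?S. Poly_Mapping.lookup ?F e) = (\<Sum>e\<in>g ` {..n}. Poly_Mapping.lookup ?F e)"
      using sub merge_g by (intro sum.mono_neutral_left) (auto simp: in_keys_iff)
    also have "\<dots> = (\<Sum>s\<le>n. Poly_Mapping.lookup ?F (g s))"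
      by (simp add: sum.reindex[OF inj])
    also have "\<dots> = 0"
    proof (cases "Poly_Mapping.keys m \<subseteq> {..<d}")
      case True
      define q :: "('n \<times> nat, 'k) mpoly" where
        "q = (\<Prod>c\<in>{..<d}-{a}-{b}. Var (i c, Poly_Mapping.lookup m c))"
      have "coloured d i (g s) = q * (Var (i a, s) * Var (i b, n - s))" for s
      proof -
        have "coloured d i (g s) = Var (i a, s) * (Var (i b, n - s) *
            (\<Prod>c\<in>{..<d}-{a}-{b}. Var (i c, Poly_Mapping.lookup (g s) c)))"
          using ab by (simp add: coloured_def prod.remove[of "{..<d}" a]
              prod.remove[of "{..<d} - {a}" b] g)
        also have "(\<Prod>c\<in>{..<d}-{a}-{b}. Var (i c, Poly_Mapping.lookup (g s) c)) = q"
          unfolding q_def by (rule prod.cong) (auto simp: g)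
        finally show ?thesis by (simp add: mult_ac)
      qed
      moreover have "Poly_Mapping.keys (g s) \<subseteq> {..<d}" for s
      proof -
        have "Poly_Mapping.keys (g s) \<subseteq> insert a (insert b (Poly_Mapping.keys m))"
          by (auto simp: in_keys_iff g split: if_splits)
        thus ?thesis using True ab by auto
      qed
      ultimately have "(\<Sum>s\<le>n. Poly_Mapping.lookup ?F (g s)) = pairing f (q * arc_generator (i a) (i b) n)"
        by (simp add: lookup_generating_poly arc_generator_def sum_distrib_left pairing_sum_right)
      thus ?thesis using arc_perp_pairing[OF f] by simp
    next
      case False
      then obtain c where c: "c \<in> Poly_Mapping.keys m" "\<not> c < d" by auto
      have "c \<in> Poly_Mapping.keys (g s)" for s
        using c ab by (auto simp: in_keys_iff g)
      hence "\<not> Poly_Mapping.keys (g s) \<subseteq> {..<d}" for s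
        using c by auto
      thus ?thesis by (simp add: lookup_generating_poly)
    qed
    finally show ?thesis .
  qed
  thus "Poly_Mapping.lookup (identify a b ?F) m = Poly_Mapping.lookup 0 m"
    by (simp add: lookup_identify)
qed

lemma vandermonde_dvd_generating_poly:
  fixes f :: "('n::finite \<times> nat, 'k::field_char_0) mpoly"
  assumes f: "f \<in> arc_perp"
  shows "vandermonde d dvd generating_poly f d i"
proof -
  define P where "P = (\<lambda>(b, a). (a, b)) ` (SIGMA b:{..<d}. {..<b})"
  have inj: "inj_on (\<lambda>(b, a). (a, b)) (SIGMA b:{..<d}. {..<b})"
    by (auto simp: inj_on_def)
  have "vandermonde d = (\<Prod>(a, b)\<in>P. Var b - Var a :: (nat, 'k) mpoly)"
    unfolding vandermonde_def P_def prod.reindex[OF inj]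
    by (simp add: prod.Sigma case_prod_unfold)
  also have "\<dots> dvd generating_poly f d i"
    by (rule prod_differences_dvd) (auto simp: P_def intro!: identify_generating_poly[OF f])
  finally show ?thesis .
qed

text \<open>A sequence of \<open>d\<close> arc variables is a sequence of colours together with a sequence of orders. Grouping
  the Taylor sum by colours gives for each of them the image of one generating polynomial.\<close>

lemma taylor_part_umbral:
  fixes f :: "('n::finite \<times> nat, 'k::field_char_0) mpoly"
  assumes "vars f \<subseteq> UNIV \<times> {..N}"
  shows "taylor_part (UNIV \<times> {..N}) d f = (\<Sum>i\<in>{..<d} \<rightarrow>\<^sub>E UNIV. umbral d i (generating_poly f d i))"
proof -
  let ?V = "{..<d} \<rightarrow>\<^sub>E UNIV \<times> {..N} :: (nat \<Rightarrow> 'n \<times> nat) set"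
  let ?I = "{..<d} \<rightarrow>\<^sub>E UNIV :: (nat \<Rightarrow> 'n) set"
  let ?T = "SIGMA i:?I. Poly_Mapping.keys (generating_poly f d i)"
  let ?fw = "\<lambda>u :: nat \<Rightarrow> 'n \<times> nat. (\<lambda>a\<in>{..<d}. fst (u a), exponents d (\<lambda>a. snd (u a)))"
  let ?bw = "\<lambda>(i :: nat \<Rightarrow> 'n, e). \<lambda>a\<in>{..<d}. (i a, Poly_Mapping.lookup e a)"
  let ?x = "\<lambda>u. \<Prod>a<d. Var (u a) :: ('n \<times> nat, 'k) mpoly"
  have fin: "finite ?I" "finite ?V" by (auto intro!: finite_PiE)
  have coloured_fw: "coloured d (fst (?fw u)) (snd (?fw u)) = ?x u" for u
    by (simp add: coloured_def lookup_exponents)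
  have coloured_bw: "?x (?bw (i, e)) = coloured d i e" for i e
    by (simp add: coloured_def)
  have keys_fw: "Poly_Mapping.keys (snd (?fw u)) \<subseteq> {..<d}" for u :: "nat \<Rightarrow> 'n \<times> nat"
    by (auto simp: in_keys_iff lookup_exponents split: if_splits)
  have "taylor_part (UNIV \<times> {..N}) d f = (\<Sum>(i, e)\<in>?T. Const (Poly_Mapping.lookup (generating_poly f d i) e) * coloured d i e)"
    unfolding taylor_part_def
  \<comment> \<open>Sequences pairing to zero with \<open>f\<close> correspond to exponents outside the support of the generating polynomial.\<close>
  proof (rule sum.reindex_bij_witness_not_neutral[where i = ?bw and j = ?fw and
        S' = "{u \<in> ?V. pairing f (?x u) = 0}" and T' = "{}"])
    fix u assume "u \<in> ?V - {u \<in> ?V. pairing f (?x u) = 0}"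
    hence u: "u \<in> ?V" "pairing f (?x u) \<noteq> 0" by auto
    show "?bw (?fw u) = u"
      using u by (auto simp: lookup_exponents PiE_def extensional_def fun_eq_iff)
    show "?fw u \<in> ?T - {}"
      using u coloured_fw[of u] keys_fw[of u] by (simp add: in_keys_iff lookup_generating_poly)
  next
    fix t assume t: "t \<in> ?T - {}"
    obtain i e where ie: "t = (i, e)" by (cases t)
    have i: "i \<in> ?I" and e: "Poly_Mapping.keys e \<subseteq> {..<d}" "pairing f (coloured d i e) \<noteq> 0"
      using t ie by (auto simp: in_keys_iff lookup_generating_poly split: if_splits)
    show "?fw (?bw t) = t"
    proof -
      have "exponents d (\<lambda>a. snd (?bw (i, e) a)) = e"
        using e(1) by (intro poly_mapping_eqI) (auto simp: lookup_exponents in_keys_iff)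
      moreover have "(\<lambda>a\<in>{..<d}. fst (?bw (i, e) a)) = i"
        using i by (auto simp: PiE_def extensional_def fun_eq_iff)
      ultimately show ?thesis by (simp add: ie)
    qed
    have "(i a, Poly_Mapping.lookup e a) \<in> vars f" if "a < d" for a
      using pairing_prod_Var_eq_0[of "{..<d}" a "\<lambda>a. (i a, Poly_Mapping.lookup e a)" f] e(2) that
      unfolding coloured_def by blast
    hence "?bw (i, e) \<in> ?V" using assms by auto
    thus "?bw t \<in> ?V - {u \<in> ?V. pairing f (?x u) = 0}"
      using e(2) coloured_bw[of i e] by (simp add: ie)
  next
    fix u assume "u \<in> ?V"
    show "(case ?fw u of (i, e) \<Rightarrow> Const (Poly_Mapping.lookup (generating_poly f d i) e) * coloured d i e) =
        Const (pairing f (?x u)) * ?x u"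
      using coloured_fw[of u] keys_fw[of u] by (simp add: lookup_generating_poly)
  qed (use fin in auto)
  also have "\<dots> = (\<Sum>i\<in>?I. umbral d i (generating_poly f d i))"
    using fin by (simp add: umbral_def sum.Sigma)
  finally show ?thesis .
qed

section \<open>The inverse system\<close>

theorem theorem3p1:
  shows "inverse_system
           (arc_ideal (double_point_ideal :: ('n::finite, 'k::field_char_0) mpoly set)) =
         linear_span (\<Union>S\<in>{S. finite S \<and> S \<subseteq> range Var}. set_wronskians S)"
proof
  show "linear_span wronskians \<subseteq>
    inverse_system (arc_ideal (double_point_ideal :: ('n, 'k) mpoly set))"
  proof (rule linear_span_subset)
    show "wronskians \<subseteq> inverse_system (arc_ideal (double_point_ideal :: ('n, 'k) mpoly set))"
    proof
      fix w :: "('n \<times> nat, 'k) mpoly" assume "w \<in> wronskians"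
      then obtain fs where w: "w = wronskian fs" "set fs \<subseteq> range Var"
        by (auto simp: set_wronskians_def)
      have "\<exists>v. x = Var v" if "x \<in> set fs" for x using w(2) that by auto
      then obtain v where v: "\<And>x. x \<in> set fs \<Longrightarrow> x = Var (v x)" by metis
      \<comment> \<open>The shape in which the Wronskian is known to be orthogonal to the arc ideal.\<close>
      have "fs = map (\<lambda>a. Var (fst (v (fs ! a)), snd (v (fs ! a)))) [0..<length fs]"
        by (rule nth_equalityI) (auto simp flip: v)
      hence "w = wronskian (map (\<lambda>a. Var (fst (v (fs ! a)), snd (v (fs ! a)))) [0..<length fs])"
        using w(1) by (rule back_subst[of "\<lambda>gs. w = wronskian gs", rotated])
      also have "\<dots> \<in> arc_perp" by (rule wronskian_Vars_in_arc_perp)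
      finally show "w \<in> inverse_system (arc_ideal (double_point_ideal :: ('n, 'k) mpoly set))"
        by (simp add: arc_perp_def)
    qed
  qed (auto simp: inverse_system_pairing pairing_add_left pairing_Const_left)
next
  show "inverse_system (arc_ideal (double_point_ideal :: ('n, 'k) mpoly set)) \<subseteq>
    linear_span wronskians"
  proof
    fix f :: "('n \<times> nat, 'k) mpoly"
    assume "f \<in> inverse_system (arc_ideal (double_point_ideal :: ('n, 'k) mpoly set))"
    hence f: "f \<in> arc_perp" by (simp add: arc_perp_def)
    define M where "M = (\<Sum>v\<in>vars f. snd v)"
    have "snd v \<le> M" if "v \<in> vars f" for v
      unfolding M_def using that by (intro member_le_sum) auto
    hence vars: "vars f \<subseteq> UNIV \<times> {..M}" by auto
    have "finite (UNIV \<times> {..M} :: ('n \<times> nat) set)" by simp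
    then obtain N where N: "f = (\<Sum>d\<le>N. Const (inverse (fact d)) * taylor_part (UNIV \<times> {..M}) d f)"
      using vars by (rule taylor_expansion)
    have "umbral d i (generating_poly f d i) \<in> linear_span wronskians" for d i
      using vandermonde_dvd_generating_poly[OF f, of d i] umbral_vandermonde_in_span[of d i]
      by (elim dvdE) simp
    hence "taylor_part (UNIV \<times> {..M}) d f \<in> linear_span wronskians" for d
      unfolding taylor_part_umbral[OF vars] by (intro linear_span_sum)
    thus "f \<in> linear_span wronskians"
      by (subst N) (intro linear_span_sum linear_span_scale)
  qed
qed

end
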